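(* Let $p\ge 3$ be an integer, $t=2p-2$, $G=(V,E)$ a simple undirected graph in which every vertex has degree at least $1$ and at most $t+1$, and $w:E\to\mathbb{R}_{\ge 0}$ a weight function vertex-induced on every $K^p_2$ of $G$. Let $G'=(V',E')$, $w'$, $l$, $b$ be as constructed below. If $\bar M$ is a minimum weight $K^p_2$-covering co-$t$-matching of $G$, then there exists an $(l,b)$-matching $M'$ of $G'$ with $w'(M')=w(\bar M)$.
   Context: $K^p_2$ is the complete $p$-partite graph with $p$ color classes of $2$ vertices each; a "$K^p_2$ of $G$" is a subgraph of $G$ (not necessarily induced) isomorphic to it; two such are different if they are different subgraphs (they may share the vertex set). $w$ is vertex-induced on a subgraph $H$ if there is $r_H:V(H)\to\mathbb{R}$ (a potential function) with $w(u,v)=r_H(u)+r_H(v)$ for every edge of $H$; $w(H)$ is the total edge weight of $H$. $\bar M\subseteq E$ is a co-$t$-matching if $E\setminus\bar M$ is a $t$-matching; it is $K^p_2$-covering if moreover $E\setminus\bar M$ contains the edge set of no $K^p_2$ of $G$; minimum weight means of minimum total weight among such sets. A $K^p_2$ $H$ is unproblematic if some other $K^p_2$ $H'$ of $G$ shares a vertex with $H$ and $w(H)\le w(H')$, and problematic otherwise. For $A\subseteq V$ with $|A|=2p$, $G[A]$ is dense if it contains at least two different $K^p_2$'s; its core is $C_{G[A]}=\{a\in A:\ \text{all neighbours of } a \text{ lie in } A,\ \deg_G(a)=t+1\}$. For a dense $H$, $w$ is vertex-induced on $H$ with potential function $r_H$ (that of any $K^p_2$ contained in $H$); let $|C_H|=2k$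 and let $V_1,\dots,V_{p-k}$ be the color classes of a $K^p_2$ contained in $H$ that are not subsets of $C_H$ (these are the same for every $K^p_2$ in $H$); the center $c_H$ is a vertex of $C_H$ of minimum potential $r_H$. Construction: start with $G'=G$, $w'=w$ on $E$, and capacity interval $[l(v),b(v)]=[1,t+1]$ if $\deg_G(v)=t+1$, $[0,\deg_G(v)]$ otherwise, for $v\in V$. For each problematic $K^p_2$ $H$ with color classes $V_1(H),\dots,V_p(H)$ and potential $r_H$, add vertices $u^1_H,\dots,u^p_H$ (interval $[1,1]$), $z_H$ (interval $[p-2,p-2]$), edges $(v,u^i_H)$ of weight $r_H(v)$ for $v\in V_i(H)$ and edges $(u^i_H,z_H)$ of weight $0$. For each dense subgraph $H$ with $r_H(c_H)\ge 0$ add vertices $u^c_H,u^1_H,\dots,u^{p-k}_H,z_H$; edges $(v,u^i_H)$ of weight $r_H(v)$ for $v\in V_i$ and $(u^i_H,z_H)$ of weight $0$; two parallel edges $(c_H,u^c_H)$ each of weight $r_H(c_H)$ and two parallel edges $(u^c_H,z_H)$ of weight $0$; capacity intervals $[p-k,p-k]$ for $z_H$, $[2,2]$ for $u^c_H$, $[1,1]$ for $u^i_H$. Dense subgraphs with $r_H(c_H)<0$ get nothing. An $(l,b)$-matching of the multigraph $G'$ is a set $M'\subseteq E'$ with $l(v)\le\deg_{M'}(v)\le b(v)$ for all $v\in V'$; $w'(M')$ is its total weight. *)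

theory Defs
  imports Complex_Main
begin

datatype 'a graph = Graph (verts: "'a set") (edges: "'a set set")

definition finite_simple_graph :: "'a graph \<Rightarrow> bool" where
  "finite_simple_graph G \<longleftrightarrow>
     finite (verts G) \<and> (\<forall>e\<in>edges G. e \<subseteq> verts G \<and> card e = 2)"

definition degree :: "'a set set \<Rightarrow> 'a \<Rightarrow> nat" where
  "degree F v = card {e\<in>F. v \<in> e}"

definition subgraph :: "'a graph \<Rightarrow> 'a graph \<Rightarrow> bool" where
  "subgraph H G \<longleftrightarrow>
     verts H \<subseteq> verts G \<and> edges H \<subseteq> edges G \<and> (\<forall>e\<in>edges H. e \<subseteq> verts H)"

definition induced_subgraph :: "'a graph \<Rightarrow> 'a set \<Rightarrow> 'a graph" where
  "induced_subgraph G A = Graph A {e\<in>edges G. e \<subseteq> A}"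

definition isomorphic :: "'a graph \<Rightarrow> 'b graph \<Rightarrow> bool" where
  "isomorphic G H \<longleftrightarrow>
     (\<exists>f. bij_betw f (verts G) (verts H) \<and> edges H = (\<lambda>e. f ` e) ` edges G)"

definition complete_multipartite :: "nat \<Rightarrow> nat \<Rightarrow> (nat \<times> nat) graph" where
  "complete_multipartite p s =
     Graph ({..<p} \<times> {..<s})
       {{(i, a), (j, b)} | i a j b. i < p \<and> j < p \<and> a < s \<and> b < s \<and> i \<noteq> j}"

definition Kp2s :: "nat \<Rightarrow> 'a graph \<Rightarrow> 'a graph set" where
  "Kp2s p G = {H. subgraph H G \<and> isomorphic (complete_multipartite p 2) H}"

text \<open>
  In a complete multipartite graph, the color class of \<open>v\<close> consists of the vertices not adjacent
  to \<open>v\<close>, including \<open>v\<close> itself.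
\<close>

definition color_classes :: "'a graph \<Rightarrow> 'a set set" where
  "color_classes H = (\<lambda>v. {u\<in>verts H. {u, v} \<notin> edges H}) ` verts H"

definition is_potential :: "('a set \<Rightarrow> real) \<Rightarrow> 'a graph \<Rightarrow> ('a \<Rightarrow> real) \<Rightarrow> bool" where
  "is_potential w H r \<longleftrightarrow> (\<forall>u v. {u, v} \<in> edges H \<longrightarrow> w {u, v} = r u + r v)"

definition vertex_induced :: "('a set \<Rightarrow> real) \<Rightarrow> 'a graph \<Rightarrow> bool" where
  "vertex_induced w H \<longleftrightarrow> (\<exists>r. is_potential w H r)"

text \<open>
  The potential is only used where it is determined on the vertices of \<open>H\<close> by \<open>w\<close>: for \<open>H\<close> a
  \<open>K\<^sup>p\<^sub>2\<close> with \<open>p \<ge> 3\<close>, and for a dense \<open>G[A]\<close>, on which it is the potential of any \<open>K\<^sup>p\<^sub>2\<close>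
  contained in \<open>G[A]\<close>. Values outside \<open>verts H\<close> are arbitrary and never used.
\<close>

definition potential :: "('a set \<Rightarrow> real) \<Rightarrow> 'a graph \<Rightarrow> 'a \<Rightarrow> real" where
  "potential w H = (SOME r. is_potential w H r)"

definition t_matching :: "'a graph \<Rightarrow> nat \<Rightarrow> 'a set set \<Rightarrow> bool" where
  "t_matching G t M \<longleftrightarrow> M \<subseteq> edges G \<and> (\<forall>v\<in>verts G. degree M v \<le> t)"

definition co_t_matching :: "'a graph \<Rightarrow> nat \<Rightarrow> 'a set set \<Rightarrow> bool" where
  "co_t_matching G t N \<longleftrightarrow> N \<subseteq> edges G \<and> t_matching G t (edges G - N)"

definition Kp2_covering_co_t_matching :: "nat \<Rightarrow> 'a graph \<Rightarrow> nat \<Rightarrow> 'a set set \<Rightarrow> bool" where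
  "Kp2_covering_co_t_matching p G t N \<longleftrightarrow>
     co_t_matching G t N \<and> \<not> (\<exists>H\<in>Kp2s p G. edges H \<subseteq> edges G - N)"

definition min_weight_Kp2_covering_co_t_matching ::
    "nat \<Rightarrow> 'a graph \<Rightarrow> nat \<Rightarrow> ('a set \<Rightarrow> real) \<Rightarrow> 'a set set \<Rightarrow> bool" where
  "min_weight_Kp2_covering_co_t_matching p G t w N \<longleftrightarrow>
     Kp2_covering_co_t_matching p G t N \<and>
     (\<forall>N'. Kp2_covering_co_t_matching p G t N' \<longrightarrow> sum w N \<le> sum w N')"

definition unproblematic :: "nat \<Rightarrow> 'a graph \<Rightarrow> ('a set \<Rightarrow> real) \<Rightarrow> 'a graph \<Rightarrow> bool" where
  "unproblematic p G w H \<longleftrightarrow>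
     (\<exists>H'\<in>Kp2s p G. H' \<noteq> H \<and> verts H \<inter> verts H' \<noteq> {} \<and> sum w (edges H) \<le> sum w (edges H'))"

definition problematic_Kp2s :: "nat \<Rightarrow> 'a graph \<Rightarrow> ('a set \<Rightarrow> real) \<Rightarrow> 'a graph set" where
  "problematic_Kp2s p G w = {H\<in>Kp2s p G. \<not> unproblematic p G w H}"

text \<open>Dense subgraphs \<open>G[A]\<close> are represented by their vertex set \<open>A\<close>.\<close>

definition dense :: "nat \<Rightarrow> 'a graph \<Rightarrow> 'a set \<Rightarrow> bool" where
  "dense p G A \<longleftrightarrow>
     A \<subseteq> verts G \<and> card A = 2 * p \<and>
     (\<exists>H1\<in>Kp2s p (induced_subgraph G A). \<exists>H2\<in>Kp2s p (induced_subgraph G A). H1 \<noteq> H2)"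

definition core :: "nat \<Rightarrow> 'a graph \<Rightarrow> 'a set \<Rightarrow> 'a set" where
  "core t G A =
     {a\<in>A. (\<forall>b. {a, b} \<in> edges G \<longrightarrow> b \<in> A) \<and> degree (edges G) a = t + 1}"

text \<open>
  For dense \<open>G[A]\<close> the result does not depend on the chosen \<open>K\<^sup>p\<^sub>2\<close>, and there are \<open>p - k\<close> such
  classes, where \<open>2k\<close> is the size of the core.
\<close>

definition outer_classes :: "nat \<Rightarrow> nat \<Rightarrow> 'a graph \<Rightarrow> 'a set \<Rightarrow> 'a set set" where
  "outer_classes p t G A =
     {X\<in>color_classes (SOME H. H \<in> Kp2s p (induced_subgraph G A)). \<not> X \<subseteq> core t G A}"

definition is_center :: "nat \<Rightarrow> 'a graph \<Rightarrow> ('a set \<Rightarrow> real) \<Rightarrow> 'a set \<Rightarrow> 'a \<Rightarrow> bool" where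
  "is_center t G w A c \<longleftrightarrow>
     c \<in> core t G A \<and>
     (\<forall>a\<in>core t G A. potential w (induced_subgraph G A) c \<le> potential w (induced_subgraph G A) a)"

definition gadget_dense ::
    "nat \<Rightarrow> 'a graph \<Rightarrow> ('a set \<Rightarrow> real) \<Rightarrow> ('a set \<Rightarrow> 'a) \<Rightarrow> 'a set set" where
  "gadget_dense p G w c =
     {A. dense p G A \<and> 0 \<le> potential w (induced_subgraph G A) (c A)}"

datatype ('v, 'e) multigraph =
  Multigraph (mverts: "'v set") (medges: "'e set") (ends: "'e \<Rightarrow> 'v set")

definition mdegree :: "('v, 'e) multigraph \<Rightarrow> 'e set \<Rightarrow> 'v \<Rightarrow> nat" where
  "mdegree G M v = card {e\<in>M. v \<in> ends G e}"

definition lb_matching ::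
    "('v, 'e) multigraph \<Rightarrow> ('v \<Rightarrow> nat) \<Rightarrow> ('v \<Rightarrow> nat) \<Rightarrow> 'e set \<Rightarrow> bool" where
  "lb_matching G l b M \<longleftrightarrow>
     M \<subseteq> medges G \<and> (\<forall>v\<in>mverts G. l v \<le> mdegree G M v \<and> mdegree G M v \<le> b v)"

text \<open>
  The vertices \<open>u\<^sup>i\<^sub>H\<close> are indexed by the color class \<open>V\<^sub>i\<close> rather than by the number \<open>i\<close>:
  \<open>ProbU H X\<close> and \<open>DenseU A X\<close> belong to the color class \<open>X\<close>, and \<open>DenseC A\<close> is the vertex
  \<open>u\<^sup>c\<close>. The Boolean argument of \<open>DenseCU\<close> and \<open>DenseUcZ\<close> distinguishes the two parallel edges.
\<close>

datatype 'a gvertex =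
    Orig 'a
  | ProbU "'a graph" "'a set"
  | ProbZ "'a graph"
  | DenseU "'a set" "'a set"
  | DenseC "'a set"
  | DenseZ "'a set"

datatype 'a gedge =
    OrigE "'a set"
  | ProbVU "'a graph" 'a "'a set"
  | ProbUZ "'a graph" "'a set"
  | DenseVU "'a set" 'a "'a set"
  | DenseUZ "'a set" "'a set"
  | DenseCU "'a set" bool
  | DenseUcZ "'a set" bool

primrec gends :: "('a set \<Rightarrow> 'a) \<Rightarrow> 'a gedge \<Rightarrow> 'a gvertex set" where
  "gends c (OrigE e) = Orig ` e"
| "gends c (ProbVU H v X) = {Orig v, ProbU H X}"
| "gends c (ProbUZ H X) = {ProbU H X, ProbZ H}"
| "gends c (DenseVU A v X) = {Orig v, DenseU A X}"
| "gends c (DenseUZ A X) = {DenseU A X, DenseZ A}"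
| "gends c (DenseCU A i) = {Orig (c A), DenseC A}"
| "gends c (DenseUcZ A i) = {DenseC A, DenseZ A}"

definition gadget_graph ::
    "nat \<Rightarrow> nat \<Rightarrow> 'a graph \<Rightarrow> ('a set \<Rightarrow> real) \<Rightarrow> ('a set \<Rightarrow> 'a) \<Rightarrow>
      ('a gvertex, 'a gedge) multigraph" where
  "gadget_graph p t G w c =
     Multigraph
       (Orig ` verts G
        \<union> {ProbU H X | H X. H \<in> problematic_Kp2s p G w \<and> X \<in> color_classes H}
        \<union> {ProbZ H | H. H \<in> problematic_Kp2s p G w}
        \<union> {DenseU A X | A X. A \<in> gadget_dense p G w c \<and> X \<in> outer_classes p t G A}
        \<union> {DenseC A | A. A \<in> gadget_dense p G w c}
        \<union> {DenseZ A | A. A \<in> gadget_dense p G w c})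
       (OrigE ` edges G
        \<union> {ProbVU H v X | H v X. H \<in> problematic_Kp2s p G w \<and> X \<in> color_classes H \<and> v \<in> X}
        \<union> {ProbUZ H X | H X. H \<in> problematic_Kp2s p G w \<and> X \<in> color_classes H}
        \<union> {DenseVU A v X | A v X.
             A \<in> gadget_dense p G w c \<and> X \<in> outer_classes p t G A \<and> v \<in> X}
        \<union> {DenseUZ A X | A X. A \<in> gadget_dense p G w c \<and> X \<in> outer_classes p t G A}
        \<union> {DenseCU A i | A i. A \<in> gadget_dense p G w c}
        \<union> {DenseUcZ A i | A i. A \<in> gadget_dense p G w c})
       (gends c)"

primrec gadget_weight ::
    "'a graph \<Rightarrow> ('a set \<Rightarrow> real) \<Rightarrow> ('a set \<Rightarrow> 'a) \<Rightarrow> 'a gedge \<Rightarrow> real" where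
  "gadget_weight G w c (OrigE e) = w e"
| "gadget_weight G w c (ProbVU H v X) = potential w H v"
| "gadget_weight G w c (ProbUZ H X) = 0"
| "gadget_weight G w c (DenseVU A v X) = potential w (induced_subgraph G A) v"
| "gadget_weight G w c (DenseUZ A X) = 0"
| "gadget_weight G w c (DenseCU A i) = potential w (induced_subgraph G A) (c A)"
| "gadget_weight G w c (DenseUcZ A i) = 0"

primrec gadget_lower :: "nat \<Rightarrow> nat \<Rightarrow> 'a graph \<Rightarrow> 'a gvertex \<Rightarrow> nat" where
  "gadget_lower p t G (Orig v) = (if degree (edges G) v = t + 1 then 1 else 0)"
| "gadget_lower p t G (ProbU H X) = 1"
| "gadget_lower p t G (ProbZ H) = p - 2"
| "gadget_lower p t G (DenseU A X) = 1"
| "gadget_lower p t G (DenseC A) = 2"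
| "gadget_lower p t G (DenseZ A) = p - card (core t G A) div 2"

primrec gadget_upper :: "nat \<Rightarrow> nat \<Rightarrow> 'a graph \<Rightarrow> 'a gvertex \<Rightarrow> nat" where
  "gadget_upper p t G (Orig v) =
     (if degree (edges G) v = t + 1 then t + 1 else degree (edges G) v)"
| "gadget_upper p t G (ProbU H X) = 1"
| "gadget_upper p t G (ProbZ H) = p - 2"
| "gadget_upper p t G (DenseU A X) = 1"
| "gadget_upper p t G (DenseC A) = 2"
| "gadget_upper p t G (DenseZ A) = p - card (core t G A) div 2"

end

theory Submission
  imports Defs
begin

text \<open>
  A \<open>K\<^sup>p\<^sub>2\<close> is the complement of a perfect matching on \<open>2p\<close> vertices, so a dense \<open>G[A]\<close> is the complement
  of a matching on \<open>A\<close> whose unmatched vertices form the core. The degree bound makes \<open>A\<close> the vertex set of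
  every \<open>K\<^sup>p\<^sub>2\<close> meeting it, hence all gadgets live on pairwise disjoint vertex sets. A covering set meets
  every \<open>K\<^sup>p\<^sub>2\<close> on \<open>A\<close> iff it touches a noncore vertex inside \<open>A\<close> or has degree at least 2 at a core
  vertex. Since \<open>w\<close> is given by potentials on \<open>A\<close> and the center \<open>c\<close> has the least potential in the core,
  edge exchanges inside \<open>A\<close> turn the minimum into another one that contains an edge between two noncore
  vertices, or an edge from a noncore vertex to \<open>c\<close>, or edges \<open>cx\<close> and \<open>cy\<close> with \<open>x, y\<close> in the core and
  \<open>xy\<close> unused. In the first two cases (as for a problematic \<open>K\<^sup>p\<^sub>2\<close>) the gadget simulates the
  half-edges of that one edge; in the last case \<open>cx, cy\<close> are traded for \<open>xy\<close> and the two parallel edges at \<open>c\<close>.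
  All these trades preserve degrees and weight exactly.
\<close>

subsection \<open>Pairings and complete multipartite graphs\<close>

text \<open>A fixed-point-free involution on \<open>A\<close>, with nothing required outside
  \<open>A\<close>. Its orbits serve as the color classes, so a \<open>K\<^sup>p\<^sub>2\<close> can
  be handled through \<open>m\<close> alone, without an isomorphism.\<close>

definition pairing :: "'a set \<Rightarrow> ('a \<Rightarrow> 'a) \<Rightarrow> bool" where
  "pairing A m \<longleftrightarrow> (\<forall>v\<in>A. m v \<in> A \<and> m v \<noteq> v \<and> m (m v) = v)"

text \<open>The condition \<open>v \<noteq> m u\<close> looks at one end only; it is symmetric once
  \<open>m\<close> is a pairing of \<open>A\<close>.\<close>

definition pair_graph :: "'a set \<Rightarrow> ('a \<Rightarrow> 'a) \<Rightarrow> 'a graph" where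
  "pair_graph A m = Graph A {{u, v} | u v. u \<in> A \<and> v \<in> A \<and> u \<noteq> v \<and> v \<noteq> m u}"

lemma verts_pair_graph [simp]: "verts (pair_graph A m) = A"
  by (simp add: pair_graph_def)

lemma pairingD:
  assumes "pairing A m" "v \<in> A"
  shows "m v \<in> A" "m v \<noteq> v" "m (m v) = v"
  using assms by (auto simp: pairing_def)

lemma pairing_eq_iff: "pairing A m \<Longrightarrow> u \<in> A \<Longrightarrow> v \<in> A \<Longrightarrow> u = m v \<longleftrightarrow> v = m u"
  by (auto simp: pairing_def)

lemma pair_graph_edge_iff:
  assumes "pairing A m"
  shows "{u, v} \<in> edges (pair_graph A m) \<longleftrightarrow> u \<in> A \<and> v \<in> A \<and> u \<noteq> v \<and> v \<noteq> m u"
proof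
  assume "{u, v} \<in> edges (pair_graph A m)"
  then obtain x y where "{u, v} = {x, y}" "x \<in> A" "y \<in> A" "x \<noteq> y" "y \<noteq> m x"
    by (auto simp: pair_graph_def)
  then show "u \<in> A \<and> v \<in> A \<and> u \<noteq> v \<and> v \<noteq> m u"
    using pairing_eq_iff[OF assms] by (auto simp: doubleton_eq_iff)
qed (auto simp: pair_graph_def)

lemma pair_graph_edgeE:
  assumes "e \<in> edges (pair_graph A m)"
  obtains u v where "e = {u, v}" "u \<in> A" "v \<in> A" "u \<noteq> v" "v \<noteq> m u"
  using assms by (auto simp: pair_graph_def)

lemma color_classes_pair_graph:
  assumes "pairing A m"
  shows "color_classes (pair_graph A m) = (\<lambda>v. {v, m v}) ` A"
proof -
  have "{u\<in>A. {u, v} \<notin> edges (pair_graph A m)} = {v, m v}" if "v \<in> A" for v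
    using that pairingD[OF assms] pairing_eq_iff[OF assms]
    by (auto simp: pair_graph_edge_iff[OF assms])
  then show ?thesis
    by (auto simp: color_classes_def)
qed

lemma card_pairs:
  assumes "pairing A m" "finite A"
  shows "card A = 2 * card ((\<lambda>v. {v, m v}) ` A)"
proof -
  let ?C = "(\<lambda>v. {v, m v}) ` A"
  have "card (\<Union>?C) = (\<Sum>X\<in>?C. card X)"
  proof (rule card_Union_disjoint)
    show "pairwise disjnt ?C"
      using assms(1) by (auto simp: pairwise_def disjnt_def pairing_def) metis+
  qed auto
  moreover have "\<Union>?C = A"
    using assms(1) by (auto simp: pairing_def)
  moreover have "(\<Sum>X\<in>?C. card X) = (\<Sum>X\<in>?C. 2)"
  proof (rule sum.cong)
    fix X assume "X \<in> ?C"
    then obtain v where "v \<in> A" "X = {v, m v}" by auto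
    then show "card X = 2" using pairingD(2)[OF assms(1), of v] by auto
  qed simp
  ultimately show ?thesis by simp
qed

lemma pair_classes_distinct:
  assumes "pairing A m" "u \<in> A" "v \<in> A" "u \<noteq> v" "v \<noteq> m u"
  shows "{u, m u} \<noteq> {v, m v}"
  using assms by (auto simp: doubleton_eq_iff)

text \<open>From left to right, the involution is transported along the isomorphism. From right to
  left, the isomorphism comes from numbering the orbits and choosing one vertex in each.\<close>

lemma isomorphic_multipartite_iff:
  "isomorphic (complete_multipartite p 2) H \<longleftrightarrow>
     (\<exists>m. pairing (verts H) m \<and> finite (verts H) \<and> card (verts H) = 2 * p
        \<and> H = pair_graph (verts H) m)"
proof
  let ?V = "{..<p} \<times> {..<2::nat}"
  assume "isomorphic (complete_multipartite p 2) H"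
  then obtain f where f: "bij_betw f ?V (verts H)"
    and edges: "edges H = (\<lambda>e. f ` e) ` edges (complete_multipartite p 2)"
    by (auto simp: isomorphic_def complete_multipartite_def)
  define g where "g = the_inv_into ?V f"
  \<comment> \<open>Since \<open>a\<close> is 0 or 1, \<open>s\<close> exchanges the two vertices of
    a class in the standard model; \<open>m\<close> is its conjugate under \<open>f\<close>.\<close>
  define s :: "nat \<times> nat \<Rightarrow> nat \<times> nat" where "s = (\<lambda>(i, a). (i, 1 - a))"
  define m where "m v = f (s (g v))" for v
  have gf: "g (f x) = x" if "x \<in> ?V" for x
    using f that by (auto simp: g_def bij_betw_def the_inv_into_f_f)
  have fg: "f (g v) = v" "g v \<in> ?V" if "v \<in> verts H" for v
    using f that f_the_inv_into_f_bij_betw[OF f] bij_betw_the_inv_into[OF f]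
    by (auto simp: g_def dest: bij_betwE)
  have fV: "f x \<in> verts H" if "x \<in> ?V" for x
    using f that by (auto dest: bij_betwE)
  have s: "s x \<in> ?V" "s x \<noteq> x" "s (s x) = x" if "x \<in> ?V" for x
    using that by (auto simp: s_def less_2_cases_iff)
  have pairing: "pairing (verts H) m"
    unfolding pairing_def
  proof (intro ballI conjI)
    fix v assume v: "v \<in> verts H"
    show "m v \<in> verts H" using fV s(1) fg(2)[OF v] by (simp add: m_def)
    have "g (m v) = s (g v)" using gf s(1) fg(2)[OF v] by (simp add: m_def)
    then show "m v \<noteq> v" "m (m v) = v"
      using s fg[OF v] by (metis, simp add: m_def)
  qed
  have "finite (verts H)" "card (verts H) = 2 * p"
    using bij_betw_finite[OF f] bij_betw_same_card[OF f] by (auto simp: card_cartesian_product)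
  moreover have "edges H = edges (pair_graph (verts H) m)" (is "_ = ?E")
  proof (rule set_eqI, rule iffI)
    fix e assume "e \<in> edges H"
    then obtain i a j b where e: "e = {f (i, a), f (j, b)}" "i < p" "j < p" "a < 2" "b < 2" "i \<noteq> j"
      by (auto simp: edges complete_multipartite_def)
    have "g (f (i, a)) = (i, a)" "g (f (j, b)) = (j, b)" "g (f (i, 1 - a)) = (i, 1 - a)"
      "m (f (i, a)) = f (i, 1 - a)"
      using e by (simp_all add: gf m_def s_def)
    then have "f (i, a) \<noteq> f (j, b)" "f (j, b) \<noteq> m (f (i, a))"
      using e(6) by auto
    then show "e \<in> ?E"
      using e fV by (auto simp: pair_graph_edge_iff[OF pairing])
  next
    fix e assume "e \<in> ?E"
    then obtain u v where e: "e = {u, v}" "u \<in> verts H" "v \<in> verts H" "u \<noteq> v" "v \<noteq> m u"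
      by (rule pair_graph_edgeE)
    obtain i a j b where ia: "g u = (i, a)" "g v = (j, b)" by fastforce
    have lt: "i < p" "a < 2" "j < p" "b < 2" using fg(2)[OF e(2)] fg(2)[OF e(3)] ia by auto
    have "i \<noteq> j"
    proof
      assume "i = j"
      then have "g v = g u \<or> g v = s (g u)" using ia lt by (auto simp: s_def less_2_cases_iff)
      then show False using e fg(1) by (metis m_def)
    qed
    then have "{(i, a), (j, b)} \<in> edges (complete_multipartite p 2)"
      using lt by (auto simp: complete_multipartite_def)
    moreover have "e = f ` {(i, a), (j, b)}"
      using e fg ia by (metis image_empty image_insert)
    ultimately show "e \<in> edges H" unfolding edges by blast
  qed
  then have "H = pair_graph (verts H) m"
    by (metis graph.expand verts_pair_graph)
  ultimately show "\<exists>m. pairing (verts H) m \<and> finite (verts H) \<and> card (verts H) = 2 * p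
      \<and> H = pair_graph (verts H) m"
    using pairing by blast
next
  let ?V = "{..<p} \<times> {..<2::nat}"
  assume "\<exists>m. pairing (verts H) m \<and> finite (verts H) \<and> card (verts H) = 2 * p
      \<and> H = pair_graph (verts H) m"
  then obtain m where m: "pairing (verts H) m" and fin: "finite (verts H)"
    and card: "card (verts H) = 2 * p" and H: "H = pair_graph (verts H) m"
    by blast
  let ?A = "verts H"
  let ?C = "(\<lambda>v. {v, m v}) ` ?A"
  have "card ?C = p" "finite ?C" using card_pairs[OF m fin] card fin by auto
  then obtain h where h: "bij_betw h {..<p} ?C"
    using ex_bij_betw_nat_finite[of ?C] by (auto simp: atLeast0LessThan)
  \<comment> \<open>A representative of class number \<open>i\<close>; the second vertex of that
    class is \<open>m (g i)\<close>.\<close>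
  define g where "g i = (SOME v. v \<in> ?A \<and> h i = {v, m v})" for i
  have g: "g i \<in> ?A" "h i = {g i, m (g i)}" if "i < p" for i
  proof -
    have "h i \<in> ?C" using h that by (auto dest: bij_betwE)
    then have "\<exists>v. v \<in> ?A \<and> h i = {v, m v}" by auto
    from someI_ex[OF this] show "g i \<in> ?A" "h i = {g i, m (g i)}" by (auto simp: g_def)
  qed
  have h_inj: "i = j" if "h i = h j" "i < p" "j < p" for i j
    using h that by (auto simp: bij_betw_def inj_on_def)
  have hi: "h i = h j" if "i < p" "j < p" "g i = g j \<or> g i = m (g j) \<or> m (g i) = m (g j) \<or> m (g i) = g j"
    for i j
    using that g[of i] g[of j] pairingD[OF m] by (metis insert_commute)
  define f where "f = (\<lambda>(i, a::nat). if a = 0 then g i else m (g i))"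
  have inj: "inj_on f ?V"
  proof (rule inj_onI)
    fix x y assume xy: "x \<in> ?V" "y \<in> ?V" "f x = f y"
    obtain i a j b where "x = (i, a)" "y = (j, b)" by fastforce
    moreover from this have "i = j"
      using xy hi[of i j] h_inj[of i j] by (auto simp: f_def split: if_splits)
    ultimately show "x = y"
      using xy pairingD(2)[OF m g(1), of i]
      by (auto simp: f_def less_2_cases_iff split: if_splits)
  qed
  have sub: "f ` ?V \<subseteq> ?A"
    using g(1) pairingD[OF m] by (auto simp: f_def)
  have "f ` ?V = ?A"
    by (rule card_subset_eq[OF fin sub]) (simp add: card_image[OF inj] card card_cartesian_product)
  then have bij: "bij_betw f ?V ?A" using inj by (simp add: bij_betw_def)
  have mate: "m (f (i, a)) = f (i, 1 - a)" if "i < p" "a < 2" for i a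
    using that g pairingD[OF m] by (auto simp: f_def less_2_cases_iff)
  have "edges H = (\<lambda>e. f ` e) ` edges (complete_multipartite p 2)"
  proof (rule set_eqI, rule iffI)
    fix e assume "e \<in> edges H"
    then obtain u v where e: "e = {u, v}" "u \<in> ?A" "v \<in> ?A" "u \<noteq> v" "v \<noteq> m u"
      by (subst (asm) H) (rule pair_graph_edgeE)
    then obtain i a j b where ia: "u = f (i, a)" "v = f (j, b)" "i < p" "a < 2" "j < p" "b < 2"
    proof -
      have "u \<in> f ` ?V" "v \<in> f ` ?V" using e \<open>f ` ?V = ?A\<close> by auto
      then show thesis using that by auto
    qed
    have "i \<noteq> j"
    proof
      assume "i = j"
      then have "b = a \<or> b = 1 - a" using ia by auto
      then show False using e ia mate \<open>i = j\<close> by auto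
    qed
    then have "{(i, a), (j, b)} \<in> edges (complete_multipartite p 2)"
      using ia by (auto simp: complete_multipartite_def)
    moreover have "e = f ` {(i, a), (j, b)}" using e ia by simp
    ultimately show "e \<in> (\<lambda>e. f ` e) ` edges (complete_multipartite p 2)" by blast
  next
    fix e assume "e \<in> (\<lambda>e. f ` e) ` edges (complete_multipartite p 2)"
    then obtain i a j b where e: "e = {f (i, a), f (j, b)}" "i < p" "j < p" "a < 2" "b < 2" "i \<noteq> j"
      by (auto simp: complete_multipartite_def)
    have V: "(i, a) \<in> ?V" "(j, b) \<in> ?V" "(i, 1 - a) \<in> ?V" using e by auto
    have "f (j, b) \<noteq> f (i, a)" "f (j, b) \<noteq> f (i, 1 - a)"
      using inj_onD[OF inj _ V(2,1)] inj_onD[OF inj _ V(2,3)] e by auto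
    then have "{f (i, a), f (j, b)} \<in> edges (pair_graph ?A m)"
      using V sub e mate by (subst pair_graph_edge_iff[OF m]) (auto simp: image_subset_iff)
    then show "e \<in> edges H" using H e by simp
  qed
  then show "isomorphic (complete_multipartite p 2) H"
    using bij by (auto simp: isomorphic_def complete_multipartite_def)
qed

lemma Kp2s_E:
  assumes "H \<in> Kp2s p G"
  obtains m where "pairing (verts H) m" "finite (verts H)" "card (verts H) = 2 * p"
    "H = pair_graph (verts H) m" "verts H \<subseteq> verts G" "edges H \<subseteq> edges G"
  using assms by (auto simp: Kp2s_def isomorphic_multipartite_iff subgraph_def)

lemma pair_graph_in_Kp2s:
  assumes "pairing A m" "finite A" "card A = 2 * p" "A \<subseteq> verts G"
    and "\<And>u v. u \<in> A \<Longrightarrow> v \<in> A \<Longrightarrow> u \<noteq> v \<Longrightarrow> v \<noteq> m u \<Longrightarrow> {u, v} \<in> edges G"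
  shows "pair_graph A m \<in> Kp2s p G"
  using assms
  by (auto simp: Kp2s_def isomorphic_multipartite_iff subgraph_def elim!: pair_graph_edgeE)

section \<open>Degrees as neighbor counts and weights as vertex sums\<close>

lemma degree_eq_card_neighbors:
  assumes "\<forall>e\<in>F. card e = 2"
  shows "degree F v = card {u. {v, u} \<in> F}"
proof -
  have "bij_betw (\<lambda>u. {v, u}) {u. {v, u} \<in> F} {e\<in>F. v \<in> e}"
    unfolding bij_betw_def
  proof
    show "inj_on (\<lambda>u. {v, u}) {u. {v, u} \<in> F}"
      by (auto simp: inj_on_def doubleton_eq_iff)
    show "(\<lambda>u. {v, u}) ` {u. {v, u} \<in> F} = {e \<in> F. v \<in> e}"
    proof (intro set_eqI iffI)
      fix e assume e: "e \<in> {e \<in> F. v \<in> e}"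
      then obtain x y where "e = {x, y}" using assms by (auto simp: card_2_iff)
      with e show "e \<in> (\<lambda>u. {v, u}) ` {u. {v, u} \<in> F}"
        by (auto simp: image_iff insert_commute)
    qed auto
  qed
  then show ?thesis by (simp add: degree_def bij_betw_same_card)
qed

text \<open>Double counting: each edge contributes the potential of both of its ends.\<close>

lemma sum_potential:
  fixes r :: "'a \<Rightarrow> real"
  assumes "finite V" "finite F" "\<forall>e\<in>F. card e = 2 \<and> e \<subseteq> V"
    and "\<And>u v. {u, v} \<in> F \<Longrightarrow> w {u, v} = r u + r v"
  shows "sum w F = (\<Sum>v\<in>V. degree F v * r v)"
proof -
  have "sum w F = (\<Sum>e\<in>F. \<Sum>v\<in>V. if v \<in> e then r v else 0)"
  proof (rule sum.cong)
    fix e assume e: "e \<in> F"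
    then obtain x y where xy: "e = {x, y}" "x \<noteq> y" using assms(3) by (auto simp: card_2_iff)
    have "(\<Sum>v\<in>V. if v \<in> e then r v else 0) = sum r e"
      using assms(1,3) e by (simp add: sum.inter_restrict[symmetric] Int_absorb1)
    then show "w e = (\<Sum>v\<in>V. if v \<in> e then r v else 0)"
      using assms(4) e xy by simp
  qed simp
  also have "\<dots> = (\<Sum>v\<in>V. \<Sum>e\<in>F. if v \<in> e then r v else 0)"
    by (rule sum.swap)
  also have "\<dots> = (\<Sum>v\<in>V. degree F v * r v)"
    using assms(2) by (simp add: degree_def sum.If_cases Int_def)
  finally show ?thesis .
qed

subsection \<open>Dense subgraphs\<close>

text \<open>Collects the hypotheses of the theorem except minimality of the given set, because that
  set is exchanged for others of the same weight during the proof.\<close>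

locale kp2_instance =
  fixes p t :: nat
    and G :: "'a graph"
    and w :: "'a set \<Rightarrow> real"
    and c :: "'a set \<Rightarrow> 'a"
  assumes p: "p \<ge> 3"
    and t: "t = 2 * p - 2"
    and fsg: "finite_simple_graph G"
    and degree_bounds: "\<forall>v\<in>verts G. 1 \<le> degree (edges G) v \<and> degree (edges G) v \<le> t + 1"
    and w_nonneg: "\<forall>e\<in>edges G. 0 \<le> w e"
    and w_induced: "\<forall>H\<in>Kp2s p G. vertex_induced w H"
    and center: "\<forall>A. dense p G A \<longrightarrow> is_center t G w A (c A)"
begin

lemma finite_verts: "finite (verts G)"
  and edge_subset: "e \<in> edges G \<Longrightarrow> e \<subseteq> verts G"
  and edge_card: "e \<in> edges G \<Longrightarrow> card e = 2"
  using fsg by (auto simp: finite_simple_graph_def)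

lemma finite_edges: "finite (edges G)"
  by (rule finite_subset[of _ "Pow (verts G)"]) (auto simp: finite_verts dest: edge_subset)

lemma edge_neq: "{u, v} \<in> edges G \<Longrightarrow> u \<noteq> v"
  using edge_card by fastforce

lemma edge_verts: "{u, v} \<in> edges G \<Longrightarrow> u \<in> verts G" "{u, v} \<in> edges G \<Longrightarrow> v \<in> verts G"
  using edge_subset by auto

lemma degree_sub: "F \<subseteq> edges G \<Longrightarrow> degree F v = card {u. {v, u} \<in> F}"
  by (rule degree_eq_card_neighbors) (auto dest: edge_card)

lemma degree_pos_iff: "F \<subseteq> edges G \<Longrightarrow> 1 \<le> degree F v \<longleftrightarrow> (\<exists>u. {v, u} \<in> F)"
proof -
  assume F: "F \<subseteq> edges G"
  have "{u. {v, u} \<in> F} \<subseteq> verts G" using F by (auto dest: edge_verts)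
  then have "finite {u. {v, u} \<in> F}" using finite_verts by (rule finite_subset)
  then show ?thesis unfolding degree_sub[OF F] by (simp add: Suc_le_eq card_gt_0_iff)
qed

lemma card_neighbors:
  assumes "v \<in> verts G"
  shows "finite {u. {v, u} \<in> edges G}" "card {u. {v, u} \<in> edges G} \<le> 2 * p - 1"
proof -
  show "finite {u. {v, u} \<in> edges G}"
    using finite_verts by (rule finite_subset[rotated]) (auto dest: edge_verts)
  show "card {u. {v, u} \<in> edges G} \<le> 2 * p - 1"
  proof -
    have "degree (edges G) v \<le> 2 * p - 1" using degree_bounds assms p t by fastforce
    then show ?thesis by (simp add: degree_sub)
  qed
qed

lemma is_potential_Kp2:
  assumes "H \<in> Kp2s p G"
  shows "is_potential w H (potential w H)"
proof -
  have "\<exists>r. is_potential w H r" using w_induced assms by (auto simp: vertex_induced_def)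
  then show ?thesis unfolding potential_def by (rule someI_ex)
qed

text \<open>The choice is literally the one made inside \<open>outer_classes\<close>, so the classes
  there become orbits of \<open>mate A\<close>.\<close>

definition dense_Kp2 :: "'a set \<Rightarrow> 'a graph" where
  "dense_Kp2 A = (SOME H. H \<in> Kp2s p (induced_subgraph G A))"

definition mate :: "'a set \<Rightarrow> 'a \<Rightarrow> 'a" where
  "mate A = (SOME m. pairing A m \<and> dense_Kp2 A = pair_graph A m)"

lemma Kp2s_induced_verts:
  assumes "dense p G A" "H \<in> Kp2s p (induced_subgraph G A)"
  shows "verts H = A"
proof (rule Kp2s_E[OF assms(2)])
  assume "card (verts H) = 2 * p" "verts H \<subseteq> verts (induced_subgraph G A)"
  then have "verts H \<subseteq> A" "card (verts H) = card A"
    using assms(1) by (auto simp: dense_def induced_subgraph_def)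
  moreover have "finite A" using assms(1) finite_verts by (auto simp: dense_def intro: finite_subset)
  ultimately show ?thesis by (simp add: card_subset_eq)
qed

lemma Kp2s_induced_subset: "A \<subseteq> verts G \<Longrightarrow> Kp2s p (induced_subgraph G A) \<subseteq> Kp2s p G"
  by (auto simp: Kp2s_def subgraph_def induced_subgraph_def)

context
  fixes A
  assumes dense: "dense p G A"
begin

lemma dense_subset: "A \<subseteq> verts G" and dense_card: "card A = 2 * p"
  using dense by (auto simp: dense_def)

lemma dense_finite: "finite A"
  using dense_subset finite_verts by (rule finite_subset)

lemma dense_Kp2: "dense_Kp2 A \<in> Kp2s p (induced_subgraph G A)"
  using dense someI_ex[of "\<lambda>H. H \<in> Kp2s p (induced_subgraph G A)"]
  by (auto simp: dense_def dense_Kp2_def)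

lemma mate: "pairing A (mate A)" and dense_Kp2_eq: "dense_Kp2 A = pair_graph A (mate A)"
proof -
  have "\<exists>m. pairing A m \<and> dense_Kp2 A = pair_graph A m"
    using Kp2s_E[OF dense_Kp2] Kp2s_induced_verts[OF dense dense_Kp2] by metis
  from someI_ex[OF this] show "pairing A (mate A)" "dense_Kp2 A = pair_graph A (mate A)"
    by (auto simp: mate_def)
qed

lemmas mateD = pairingD[OF mate]

lemma dense_adjacent:
  assumes "u \<in> A" "v \<in> A" "u \<noteq> v" "v \<noteq> mate A u"
  shows "{u, v} \<in> edges G"
proof -
  have "{u, v} \<in> edges (dense_Kp2 A)"
    using assms by (simp add: dense_Kp2_eq pair_graph_edge_iff[OF mate])
  then show ?thesis
    using dense_Kp2 by (auto simp: Kp2s_def subgraph_def induced_subgraph_def)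
qed

text \<open>A vertex of \<open>A\<close> is adjacent to the \<open>2p - 2\<close> vertices of
  \<open>A\<close> other than itself and its mate. As \<open>t + 1 = 2p - 1\<close>, adjacency to
  the mate uses up the whole degree inside \<open>A\<close>, and a core vertex must be adjacent to
  all the rest of \<open>A\<close>.\<close>

lemma in_core_iff: "a \<in> core t G A \<longleftrightarrow> a \<in> A \<and> {a, mate A a} \<in> edges G"
proof
  assume a: "a \<in> core t G A"
  then have "{u. {a, u} \<in> edges G} \<subseteq> A - {a}" "a \<in> A" by (auto simp: core_def dest: edge_neq)
  moreover have "card {u. {a, u} \<in> edges G} = card (A - {a})"
    using a dense_finite dense_card p by (simp add: core_def degree_sub t)
  ultimately have "{u. {a, u} \<in> edges G} = A - {a}"
    using dense_finite by (intro card_subset_eq) auto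
  then show "a \<in> A \<and> {a, mate A a} \<in> edges G"
    using \<open>a \<in> A\<close> mateD[of a] by blast
next
  assume a: "a \<in> A \<and> {a, mate A a} \<in> edges G"
  then have sub: "A - {a} \<subseteq> {u. {a, u} \<in> edges G}"
    using dense_adjacent by auto
  moreover have "card (A - {a}) = 2 * p - 1" using a dense_finite dense_card by simp
  moreover have "a \<in> verts G" using a dense_subset by blast
  note nb = card_neighbors[OF this]
  ultimately have "A - {a} = {u. {a, u} \<in> edges G}"
    by (intro card_seteq) auto
  then have "{a, b} \<in> edges G \<longleftrightarrow> b \<in> A - {a}" for b by blast
  moreover have "degree (edges G) a = t + 1"
    unfolding degree_sub[OF order_refl] \<open>A - {a} = _\<close>[symmetric]
    using \<open>card (A - {a}) = 2 * p - 1\<close> p by (simp add: t)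
  ultimately show "a \<in> core t G A"
    using a by (auto simp: core_def)
qed

lemma core_subset: "core t G A \<subseteq> A"
  by (auto simp: core_def)

lemma core_adjacent: "a \<in> core t G A \<Longrightarrow> u \<in> A \<Longrightarrow> u \<noteq> a \<Longrightarrow> {a, u} \<in> edges G"
  using dense_adjacent[of a u] by (cases "u = mate A a") (auto simp: in_core_iff)

lemma core_neighbor: "a \<in> core t G A \<Longrightarrow> {a, u} \<in> edges G \<Longrightarrow> u \<in> A"
  by (auto simp: core_def)

lemma mate_in_core_iff: "a \<in> A \<Longrightarrow> mate A a \<in> core t G A \<longleftrightarrow> a \<in> core t G A"
  using mateD[of a] by (simp add: in_core_iff insert_commute[of a])

lemma outer_nonadjacent: "a \<in> A \<Longrightarrow> a \<notin> core t G A \<Longrightarrow> {a, u} \<in> edges G \<Longrightarrow> u \<noteq> mate A a"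
  by (auto simp: in_core_iff)

lemma outer_classes_eq: "outer_classes p t G A = (\<lambda>v. {v, mate A v}) ` (A - core t G A)"
proof -
  have "(SOME H. H \<in> Kp2s p (induced_subgraph G A)) = pair_graph A (mate A)"
    using dense_Kp2_eq by (simp add: dense_Kp2_def)
  then show ?thesis
    using mate_in_core_iff
    by (auto simp: outer_classes_def color_classes_pair_graph[OF mate])
qed

text \<open>\<open>mate A\<close> preserves the complement of the core, so its orbits there halve
  that complement. The resulting number is the capacity of \<open>DenseZ A\<close>.\<close>

lemma card_outer_classes: "card (outer_classes p t G A) = p - card (core t G A) div 2"
proof -
  have "pairing (A - core t G A) (mate A)"
    using mate mate_in_core_iff by (auto simp: pairing_def)
  then have "card (A - core t G A) = 2 * card (outer_classes p t G A)"
    using dense_finite by (simp add: outer_classes_eq card_pairs)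
  moreover have "card (A - core t G A) = 2 * p - card (core t G A)" "card (core t G A) \<le> 2 * p"
    using core_subset dense_finite card_mono[OF dense_finite core_subset]
    by (auto simp: card_Diff_subset finite_subset dense_card)
  ultimately show ?thesis by linarith
qed

text \<open>A second \<open>K\<^sup>p\<^sub>2\<close> on \<open>A\<close> has an involution
  \<open>m\<close> different from \<open>mate A\<close>. Where they differ, the second graph
  contains the edge from \<open>x\<close> to \<open>mate A x\<close>, which puts \<open>x\<close>
  into the core; this happens at both vertices of an \<open>m\<close>-pair.\<close>

lemma two_core_pairs:
  obtains u v where "u \<in> core t G A" "v \<in> core t G A" "u \<noteq> v" "v \<noteq> mate A u"
proof -
  obtain H where H: "H \<in> Kp2s p (induced_subgraph G A)" "H \<noteq> dense_Kp2 A"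
    using dense by (auto simp: dense_def)
  obtain m where m: "pairing A m" "H = pair_graph A m"
    using Kp2s_E[OF H(1)] Kp2s_induced_verts[OF dense H(1)] by metis
  have edges: "edges H \<subseteq> edges G"
    using H(1) by (auto simp: Kp2s_def subgraph_def induced_subgraph_def)
  have "\<exists>v\<in>A. m v \<noteq> mate A v"
  proof (rule ccontr)
    assume "\<not> ?thesis"
    then have "pair_graph A m = pair_graph A (mate A)"
      by (auto simp: pair_graph_def) metis+
    then show False using H m dense_Kp2_eq by simp
  qed
  then obtain v where v: "v \<in> A" "m v \<noteq> mate A v" by blast
  have core: "x \<in> core t G A" if "x \<in> A" "m x \<noteq> mate A x" for x
  proof -
    have "{x, mate A x} \<in> edges H"
      using that mateD[of x] by (auto simp: m pair_graph_edge_iff)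
    then show ?thesis using edges that by (auto simp: in_core_iff)
  qed
  have "m v \<in> A" "m v \<noteq> v" "m (m v) = v" using pairingD[OF m(1) v(1)] by auto
  moreover have "mate A (m v) \<noteq> v" using v mateD(3)[OF \<open>m v \<in> A\<close>] by metis
  ultimately show thesis
    using that[of v "m v"] core v by auto
qed

text \<open>Two core vertices that are not mates bring their mates along.\<close>

lemma core_card_ge: "4 \<le> card (core t G A)"
proof -
  obtain u v where uv: "u \<in> core t G A" "v \<in> core t G A" "u \<noteq> v" "v \<noteq> mate A u"
    by (rule two_core_pairs)
  have A: "u \<in> A" "v \<in> A" using uv core_subset by auto
  have "{u, v, mate A u, mate A v} \<subseteq> core t G A"
    using uv A mate_in_core_iff by auto
  moreover have "card {u, v, mate A u, mate A v} = 4"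
    using uv mateD[OF A(1)] mateD[OF A(2)] by (auto simp: card_insert_if)
  moreover have "finite (core t G A)" using core_subset dense_finite by (rule finite_subset)
  ultimately show ?thesis by (metis card_mono)
qed

text \<open>The core has at least four vertices and no neighbors outside \<open>A\<close>. A
  \<open>K\<^sup>p\<^sub>2\<close> that meets \<open>A\<close> and sticks out of it therefore lacks
  room, either among the noncore vertices or in the degree of a common vertex.\<close>

lemma Kp2_meets_dense:
  assumes H: "H \<in> Kp2s p G" and meet: "verts H \<inter> A \<noteq> {}"
  shows "verts H = A"
proof -
  let ?B = "verts H"
  obtain m where m: "pairing ?B m" "finite ?B" "card ?B = 2 * p" "H = pair_graph ?B m"
    "?B \<subseteq> verts G" "edges H \<subseteq> edges G"
    using H by (rule Kp2s_E)
  have adj: "{u, v} \<in> edges G" if "u \<in> ?B" "v \<in> ?B" "u \<noteq> v" "v \<noteq> m u" for u v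
    using that m(6) pair_graph_edge_iff[OF m(1)] m(4) by (metis subsetD)
  have fin_core: "finite (core t G A)" using core_subset dense_finite by (rule finite_subset)
  have "?B \<subseteq> A"
  proof (rule ccontr)
    assume "\<not> ?B \<subseteq> A"
    then obtain x where x: "x \<in> ?B" "x \<notin> A" by blast
    \<comment> \<open>A core vertex of \<open>?B\<close> is not adjacent to \<open>x\<close>, so it
      can only be the partner of \<open>x\<close>.\<close>
    have mx: "b = m x" if "b \<in> ?B" "b \<in> core t G A" for b
    proof (rule ccontr)
      assume "b \<noteq> m x"
      then have "{x, b} \<in> edges G" using adj[of x b] x that core_subset by blast
      then show False using core_neighbor[OF that(2)] x by (simp add: insert_commute)
    qed
    have "m x \<in> ?B" "m (m x) = x" using pairingD[OF m(1) x(1)] by auto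
    show False
    proof (cases "m x \<in> core t G A")
      case True
      \<comment> \<open>\<open>m x\<close> is adjacent to all of \<open>?B\<close> except
        \<open>x\<close> and itself, which forces these vertices into \<open>A\<close>. Then
        \<open>2p - 2\<close> vertices of \<open>?B\<close> are noncore, but \<open>A\<close> has at
        most \<open>2p - 4\<close> noncore vertices.\<close>
      have "?B - {x} \<subseteq> A"
      proof
        fix y assume y: "y \<in> ?B - {x}"
        show "y \<in> A"
          using y adj[of "m x" y] core_neighbor[OF True] True core_subset \<open>m x \<in> ?B\<close> \<open>m (m x) = x\<close>
          by (cases "y = m x") auto
      qed
      moreover have "card (?B - {x}) = 2 * p - 1" using m x by simp
      ultimately have "?B - {x} - {m x} \<subseteq> A - core t G A" "card (?B - {x} - {m x}) \<ge> 2 * p - 2"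
        using m(2) mx by (auto simp: card_Diff_singleton_if)
      then have "2 * p - 2 \<le> card (A - core t G A)"
        using card_mono[of "A - core t G A"] dense_finite by (meson finite_Diff le_trans)
      moreover have "card (A - core t G A) = 2 * p - card (core t G A)"
        using core_subset dense_card by (simp add: card_Diff_subset fin_core)
      ultimately show False using core_card_ge p by linarith
    next
      case False
      then have disj: "?B \<inter> core t G A = {}" using mx by auto
      obtain v where v: "v \<in> ?B" "v \<in> A" using meet by blast
      \<comment> \<open>The common vertex \<open>v\<close> is noncore. Its \<open>2p - 2\<close>
        neighbors in \<open>?B\<close> together with the core, which is disjoint from
        \<open>?B\<close>, exceed the maximum degree \<open>2p - 1\<close>.\<close>
      have "?B - {v, m v} \<union> core t G A \<subseteq> {u. {v, u} \<in> edges G}"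
      proof
        fix u assume "u \<in> ?B - {v, m v} \<union> core t G A"
        then show "u \<in> {u. {v, u} \<in> edges G}"
        proof
          assume "u \<in> core t G A"
          then show ?thesis
            using core_adjacent[of u v] v disj by (auto simp: insert_commute)
        qed (use adj v in auto)
      qed
      then have "card (?B - {v, m v} \<union> core t G A) \<le> 2 * p - 1"
        using card_neighbors[of v] v m(5) by (meson card_mono le_trans subsetD)
      moreover have "card (?B - {v, m v} \<union> core t G A) = card (?B - {v, m v}) + card (core t G A)"
        using disj m(2) fin_core by (intro card_Un_disjoint) auto
      moreover have "card (?B - {v, m v}) \<ge> 2 * p - 2"
        using m(2,3) diff_card_le_card_Diff[of "{v, m v}" ?B] by (auto simp: card_insert_if split: if_splits)
      ultimately show False using core_card_ge p by linarith
    qed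
  qed
  then show ?thesis
    using dense_finite dense_card m(3) by (simp add: card_subset_eq)
qed

end

end

subsection \<open>Potentials and local covering\<close>

lemma sum_exchange:
  fixes w :: "'b \<Rightarrow> real"
  assumes "finite N" "e \<in> N" "f \<notin> N"
  shows "sum w (insert f (N - {e})) = sum w N - w e + w f"
  using assms by (simp add: sum_diff1)

lemma degree_Kp2:
  assumes "H \<in> Kp2s p G" "v \<in> verts H"
  shows "degree (edges H) v = 2 * p - 2"
proof -
  obtain m where m: "pairing (verts H) m" "finite (verts H)" "card (verts H) = 2 * p"
    "H = pair_graph (verts H) m"
    using assms(1) by (rule Kp2s_E)
  have iff: "{x, y} \<in> edges H \<longleftrightarrow> x \<in> verts H \<and> y \<in> verts H \<and> x \<noteq> y \<and> y \<noteq> m x" for x y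
    using pair_graph_edge_iff[OF m(1)] m(4) by metis
  have "\<forall>e\<in>edges H. card e = 2"
    by (subst m(4)) (auto elim!: pair_graph_edgeE)
  then have "degree (edges H) v = card {u. {v, u} \<in> edges H}"
    by (rule degree_eq_card_neighbors)
  also have "{u. {v, u} \<in> edges H} = verts H - {v, m v}"
    using assms(2) iff by auto
  also have "card \<dots> = 2 * p - 2"
    using m(2,3) assms(2) pairingD[OF m(1) assms(2)]
    by (subst card_Diff_subset) auto
  finally show ?thesis .
qed

context kp2_instance
begin

abbreviation pot :: "'a set \<Rightarrow> 'a \<Rightarrow> real" where
  "pot A \<equiv> potential w (induced_subgraph G A)"

abbreviation minimal :: "'a set set \<Rightarrow> bool" where
  "minimal N \<equiv> min_weight_Kp2_covering_co_t_matching p G t w N"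

abbreviation covering :: "'a set set \<Rightarrow> bool" where
  "covering N \<equiv> Kp2_covering_co_t_matching p G t N"

text \<open>All degrees are at most \<open>t + 1\<close>, so the degree condition on the complement
  can fail only at a vertex of degree \<open>t + 1\<close> that \<open>N\<close> does not
  touch.\<close>

lemma covering_iff:
  "covering N \<longleftrightarrow> N \<subseteq> edges G
     \<and> (\<forall>v\<in>verts G. degree (edges G) v = t + 1 \<longrightarrow> (\<exists>u. {v, u} \<in> N))
     \<and> \<not> (\<exists>H\<in>Kp2s p G. edges H \<subseteq> edges G - N)"
proof -
  have "degree (edges G - N) v \<le> t \<longleftrightarrow> (degree (edges G) v = t + 1 \<longrightarrow> (\<exists>u. {v, u} \<in> N))"
    if N: "N \<subseteq> edges G" and v: "v \<in> verts G" for v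
  proof -
    have "{e \<in> edges G - N. v \<in> e} = {e \<in> edges G. v \<in> e} - {e \<in> N. v \<in> e}" by auto
    then have "degree (edges G - N) v = degree (edges G) v - degree N v"
      using N finite_edges finite_subset[OF N]
      by (simp add: degree_def) (subst card_Diff_subset; auto)
    moreover have "degree N v \<le> degree (edges G) v"
      unfolding degree_def using N finite_edges by (intro card_mono) auto
    ultimately show ?thesis
      using degree_pos_iff[OF N, of v] degree_bounds v by fastforce
  qed
  then show ?thesis
    unfolding Kp2_covering_co_t_matching_def co_t_matching_def t_matching_def by auto
qed

context
  fixes A
  assumes dense: "dense p G A"
begin

text \<open>The potential \<open>r\<close> of the reference \<open>K\<^sup>p\<^sub>2\<close> fits
  every edge except those joining a core vertex to its mate. Such an edge lies in another
  \<open>K\<^sup>p\<^sub>2\<close>, obtained by rewiring two core pairs, whose potential agrees with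
  \<open>r\<close> at both ends.\<close>

lemma dense_has_potential: "\<exists>r. is_potential w (induced_subgraph G A) r"
proof -
  note mateD = mateD[OF dense]
  have K: "dense_Kp2 A \<in> Kp2s p G"
    using dense_Kp2[OF dense] Kp2s_induced_subset[OF dense_subset[OF dense]] by blast
  define r where "r = potential w (dense_Kp2 A)"
  have r: "w {x, y} = r x + r y" if "x \<in> A" "y \<in> A" "x \<noteq> y" "y \<noteq> mate A x" for x y
    using that is_potential_Kp2[OF K]
    by (auto simp: r_def is_potential_def dense_Kp2_eq[OF dense] pair_graph_edge_iff[OF mate[OF dense]])
  have mates: "w {x, mate A x} = r x + r (mate A x)" if x: "x \<in> core t G A" for x
  proof -
    define y where "y = mate A x"
    have fin: "finite (core t G A)"
      using core_subset[OF dense] dense_finite[OF dense] by (rule finite_subset)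
    have "\<not> core t G A \<subseteq> {x, y}"
      using core_card_ge[OF dense] card_mono[of "{x, y}" "core t G A"] by (auto simp: card_insert_if split: if_splits)
    then obtain u where u: "u \<in> core t G A" "u \<noteq> x" "u \<noteq> y" by blast
    define v where "v = mate A u"
    have A: "x \<in> A" "u \<in> A" using x u core_subset[OF dense] by auto
    have xy: "y \<in> A" "y \<noteq> x" "mate A y = x" "mate A x = y" using mateD[OF A(1)] by (auto simp: y_def)
    have uv: "v \<in> A" "v \<noteq> u" "mate A v = u" "mate A u = v" using mateD[OF A(2)] by (auto simp: v_def)
    have vxy: "v \<noteq> x" "v \<noteq> y" using u xy uv by auto
    \<comment> \<open>As \<open>2p \<ge> 6\<close>, there is a vertex \<open>s\<close> outside the
      two pairs; it closes the triangles used below.\<close>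
    have "card {x, y, u, v} \<le> 4" by (simp add: card_insert_if)
    then have "\<not> A \<subseteq> {x, y, u, v}"
      using card_mono[of "{x, y, u, v}" A] dense_card[OF dense] p by auto
    then obtain s where s: "s \<in> A" "s \<notin> {x, y, u, v}" by blast
    \<comment> \<open>The pairs \<open>x, y\<close> and \<open>u, v\<close> are recombined into
      \<open>x, u\<close> and \<open>y, v\<close>, which makes \<open>x\<close> and \<open>y\<close>
      adjacent in the new graph. All four vertices are core, so the new edges exist in
      \<open>G\<close>.\<close>
    define m where "m = (mate A)(x := u, u := x, y := v, v := y)"
    have m_simps: "m x = u" "m u = x" "m y = v" "m v = y"
      using u xy uv vxy by (auto simp: m_def)
    have m_other: "m a = mate A a" if "a \<notin> {x, y, u, v}" for a
      using that by (auto simp: m_def)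
    have mate_other: "mate A a \<notin> {x, y, u, v}" if "a \<in> A" "a \<notin> {x, y, u, v}" for a
      using that mateD(3)[OF that(1)] xy uv by auto
    have pm: "pairing A m"
      unfolding pairing_def
    proof (intro ballI)
      fix a assume a: "a \<in> A"
      show "m a \<in> A \<and> m a \<noteq> a \<and> m (m a) = a"
      proof (cases "a \<in> {x, y, u, v}")
        case True
        then consider "a = x" | "a = y" | "a = u" | "a = v" by blast
        then show ?thesis
          by cases (simp_all add: m_simps A xy(1) uv(1) u(2) vxy(2) u(2)[symmetric] vxy(2)[symmetric])
      next
        case False
        then show ?thesis using m_other[OF False] m_other[OF mate_other[OF a False]] mateD[OF a] by simp
      qed
    qed
    have core4: "{x, y, u, v} \<subseteq> core t G A"
      using x u A mate_in_core_iff[OF dense] by (auto simp: y_def v_def)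
    define H where "H = pair_graph A m"
    have H: "H \<in> Kp2s p G"
      unfolding H_def
    proof (rule pair_graph_in_Kp2s[OF pm dense_finite[OF dense] dense_card[OF dense] dense_subset[OF dense]])
      fix a b assume ab: "a \<in> A" "b \<in> A" "a \<noteq> b" "b \<noteq> m a"
      show "{a, b} \<in> edges G"
      proof (cases "a \<in> {x, y, u, v}")
        case True
        then show ?thesis using core_adjacent[OF dense, of a b] core4 ab by blast
      next
        case False
        then show ?thesis using dense_adjacent[OF dense ab(1-3)] m_other ab(4) by auto
      qed
    qed
    define r' where "r' = potential w H"
    have r': "w {a, b} = r' a + r' b" if "a \<in> A" "b \<in> A" "a \<noteq> b" "b \<noteq> m a" for a b
      using that is_potential_Kp2[OF H]
      by (auto simp: r'_def is_potential_def H_def pair_graph_edge_iff[OF pm])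
    have both: "r a + r b = r' a + r' b" if "a \<in> A" "b \<in> A" "a \<noteq> b" "b \<noteq> m a" "b \<noteq> mate A a" for a b
      using that r r' by metis
    \<comment> \<open>The triangle \<open>x, v, s\<close> lies in both graphs, and the sums along
      its three edges determine the values at its corners. The triangle \<open>y, u, s\<close> does
      the same for \<open>y\<close>.\<close>
    have "r x = r' x"
    proof -
      have "r x + r v = r' x + r' v" "r x + r s = r' x + r' s" "r v + r s = r' v + r' s"
        by (rule both; use A xy uv u vxy s m_simps in auto)+
      then show ?thesis by linarith
    qed
    moreover have "r y = r' y"
    proof -
      have "r y + r u = r' y + r' u" "r y + r s = r' y + r' s" "r u + r s = r' u + r' s"
        by (rule both; use A xy uv u vxy s m_simps in auto)+
      then show ?thesis by linarith
    qed
    moreover have "w {x, y} = r' x + r' y"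
      by (rule r') (use A xy m_simps u in auto)
    ultimately show ?thesis by (simp add: y_def)
  qed
  have "is_potential w (induced_subgraph G A) r"
    unfolding is_potential_def
  proof (intro allI impI)
    fix x y assume "{x, y} \<in> edges (induced_subgraph G A)"
    then have xy: "{x, y} \<in> edges G" "x \<in> A" "y \<in> A" by (auto simp: induced_subgraph_def)
    show "w {x, y} = r x + r y"
    proof (cases "y = mate A x")
      case True
      then show ?thesis using mates xy in_core_iff[OF dense] by blast
    next
      case False
      then show ?thesis using r xy edge_neq by blast
    qed
  qed
  then show ?thesis by blast
qed

lemma pot:
  assumes "{x, y} \<in> edges G" "x \<in> A" "y \<in> A"
  shows "w {x, y} = pot A x + pot A y"
proof -
  have "is_potential w (induced_subgraph G A) (pot A)"
    unfolding potential_def by (rule someI_ex[OF dense_has_potential])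
  then show ?thesis using assms by (simp add: is_potential_def induced_subgraph_def)
qed

text \<open>Every \<open>K\<^sup>p\<^sub>2\<close> is regular of degree \<open>2p - 2\<close>; hence
  all those on one dense set have equal weight.\<close>

lemma weight_Kp2_dense:
  assumes "H \<in> Kp2s p G" "verts H = A"
  shows "sum w (edges H) = (\<Sum>v\<in>A. (2 * p - 2) * pot A v)"
proof -
  have H: "edges H \<subseteq> edges G" "\<forall>e\<in>edges H. e \<subseteq> A"
    using assms by (auto simp: Kp2s_def subgraph_def)
  have "sum w (edges H) = (\<Sum>v\<in>A. degree (edges H) v * pot A v)"
  proof (rule sum_potential)
    show "finite (edges H)" using H(1) finite_edges by (rule finite_subset)
    show "\<forall>e\<in>edges H. card e = 2 \<and> e \<subseteq> A" using H edge_card by auto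
    show "w {u, v} = pot A u + pot A v" if "{u, v} \<in> edges H" for u v
    proof -
      have "{u, v} \<in> edges G" "{u, v} \<subseteq> A" using that H by auto
      then show ?thesis using pot by simp
    qed
  qed (rule dense_finite[OF dense])
  also have "\<dots> = (\<Sum>v\<in>A. (2 * p - 2) * pot A v)"
    using degree_Kp2[OF assms(1)] assms(2) by (intro sum.cong) auto
  finally show ?thesis .
qed

text \<open>If \<open>H\<close> met \<open>A\<close>, it would live on \<open>A\<close>, where a
  different \<open>K\<^sup>p\<^sub>2\<close> of the same weight makes it unproblematic.\<close>

lemma problematic_disjoint_dense:
  assumes "H \<in> problematic_Kp2s p G w"
  shows "verts H \<inter> A = {}"
proof (rule ccontr)
  assume meet: "verts H \<inter> A \<noteq> {}"
  have H: "H \<in> Kp2s p G" "\<not> unproblematic p G w H"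
    using assms by (auto simp: problematic_Kp2s_def)
  have HA: "verts H = A" by (rule Kp2_meets_dense[OF dense H(1) meet])
  obtain H' where H': "H' \<in> Kp2s p (induced_subgraph G A)" "H' \<noteq> H"
    using dense by (auto simp: dense_def)
  then have K: "H' \<in> Kp2s p G" "verts H' = A"
    using Kp2s_induced_subset[OF dense_subset[OF dense]] Kp2s_induced_verts[OF dense] by auto
  have "sum w (edges H) \<le> sum w (edges H')"
    using weight_Kp2_dense H(1) HA K by simp
  then have "unproblematic p G w H"
    using H' K HA meet by (auto simp: unproblematic_def)
  then show False using H by blast
qed

lemma dense_disjoint_dense:
  assumes "dense p G B" "A \<noteq> B"
  shows "A \<inter> B = {}"
proof (rule ccontr)
  assume "A \<inter> B \<noteq> {}"
  moreover have "dense_Kp2 B \<in> Kp2s p G" "verts (dense_Kp2 B) = B"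
    using dense_Kp2[OF assms(1)] Kp2s_induced_subset[OF dense_subset[OF assms(1)]]
      Kp2s_induced_verts[OF assms(1)] by auto
  ultimately show False using Kp2_meets_dense[OF dense] assms(2) by blast
qed

end

text \<open>If two of them shared a vertex, the one that is not heavier would be
  unproblematic.\<close>

lemma problematic_disjoint:
  assumes "H \<in> problematic_Kp2s p G w" "H' \<in> problematic_Kp2s p G w" "H \<noteq> H'"
  shows "verts H \<inter> verts H' = {}"
proof (rule ccontr)
  assume "verts H \<inter> verts H' \<noteq> {}"
  then have "unproblematic p G w H \<or> unproblematic p G w H'"
    using assms linear[of "sum w (edges H)" "sum w (edges H')"]
    by (auto simp: unproblematic_def problematic_Kp2s_def)
  then show False using assms by (auto simp: problematic_Kp2s_def)
qed

section \<open>The covering condition inside a dense set\<close>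

text \<open>
  Since every core vertex is covered anyway, this is exactly the condition for the complement of
  \<open>N\<close> to contain no \<open>K\<^sup>p\<^sub>2\<close> on \<open>A\<close>.
\<close>

definition locally_covered :: "'a set \<Rightarrow> 'a set set \<Rightarrow> bool" where
  "locally_covered A N \<longleftrightarrow>
     (\<exists>a\<in>A - core t G A. \<exists>b\<in>A. {a, b} \<in> N) \<or>
     (\<exists>b\<in>core t G A. \<exists>x y. x \<noteq> y \<and> {b, x} \<in> N \<and> {b, y} \<in> N)"

lemma locally_covered_coreI:
  assumes "b \<in> core t G A" "{b, x} \<in> N" "{b, y} \<in> N" "x \<noteq> y"
  shows "locally_covered A N"
  using assms unfolding locally_covered_def by blast

context
  fixes A
  assumes dense: "dense p G A"
begin

lemma core_covered:
  assumes "covering N" "b \<in> core t G A"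
  shows "\<exists>x. {b, x} \<in> N"
  using assms core_subset[OF dense] dense_subset[OF dense] by (auto simp: covering_iff core_def)

text \<open>Otherwise no edge of \<open>N\<close> inside \<open>A\<close> touches a noncore vertex,
  and each core vertex has exactly one edge of \<open>N\<close>, so \<open>N\<close> pairs up the
  core. Completed by \<open>mate A\<close> off the core, this pairing yields a
  \<open>K\<^sup>p\<^sub>2\<close> that avoids \<open>N\<close>.\<close>

lemma covering_imp_locally_covered:
  assumes cov: "covering N"
  shows "locally_covered A N"
proof (rule ccontr)
  assume "\<not> ?thesis"
  then have outer: "{a, b} \<notin> N" if "a \<in> A" "a \<notin> core t G A" "b \<in> A" for a b
    using that by (auto simp: locally_covered_def)
  have unique: "x = y" if "b \<in> core t G A" "{b, x} \<in> N" "{b, y} \<in> N" for b x y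
    using that \<open>\<not> locally_covered A N\<close> unfolding locally_covered_def by blast
  have N: "N \<subseteq> edges G" using cov by (simp add: covering_iff)
  define \<mu> where "\<mu> b = (SOME x. {b, x} \<in> N)" for b
  have \<mu>: "{b, \<mu> b} \<in> N" if "b \<in> core t G A" for b
    using core_covered[OF cov that] someI_ex[of "\<lambda>x. {b, x} \<in> N"] by (simp add: \<mu>_def)
  have \<mu>_core: "\<mu> b \<in> core t G A" if "b \<in> core t G A" for b
  proof (rule ccontr)
    assume "\<mu> b \<notin> core t G A"
    moreover have "\<mu> b \<in> A" "b \<in> A"
      using \<mu>[OF that] N core_neighbor[OF dense that] core_subset[OF dense] that by auto
    ultimately show False using outer[of "\<mu> b" b] \<mu>[OF that] by (simp add: insert_commute)
  qed
  define m where "m v = (if v \<in> core t G A then \<mu> v else mate A v)" for v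
  have pm: "pairing A m"
    unfolding pairing_def
  proof (intro ballI)
    fix v assume v: "v \<in> A"
    show "m v \<in> A \<and> m v \<noteq> v \<and> m (m v) = v"
    proof (cases "v \<in> core t G A")
      case True
      have "{\<mu> v, v} \<in> N" using \<mu>[OF True] by (simp add: insert_commute)
      then have "\<mu> (\<mu> v) = v" using unique[OF \<mu>_core[OF True] \<mu>[OF \<mu>_core[OF True]]] by simp
      moreover have "v \<noteq> \<mu> v" using \<mu>[OF True] N edge_neq by blast
      ultimately show ?thesis
        using True \<mu>_core[OF True] core_subset[OF dense] by (auto simp: m_def)
    next
      case False
      then show ?thesis
        using mateD[OF dense v] mate_in_core_iff[OF dense v] by (simp add: m_def)
    qed
  qed
  have edge: "{u, v} \<in> edges G - N" if uv: "u \<in> A" "v \<in> A" "u \<noteq> v" "v \<noteq> m u" for u v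
  proof (cases "u \<in> core t G A")
    case True
    have "{u, v} \<notin> N" using unique[OF True _ \<mu>[OF True], of v] uv(4) True by (auto simp: m_def)
    then show ?thesis using core_adjacent[OF dense True, of v] uv by auto
  next
    case False
    then show ?thesis
      using outer[OF uv(1) False uv(2)] dense_adjacent[OF dense uv(1-3)] uv(4) by (auto simp: m_def)
  qed
  have "pair_graph A m \<in> Kp2s p G"
    by (rule pair_graph_in_Kp2s[OF pm dense_finite[OF dense] dense_card[OF dense] dense_subset[OF dense]])
      (use edge in blast)
  moreover have "edges (pair_graph A m) \<subseteq> edges G - N"
    by (auto elim!: pair_graph_edgeE dest: edge)
  ultimately show False using cov by (auto simp: covering_iff)
qed

text \<open>On \<open>A\<close>, \<open>H\<close> omits only the pairs of \<open>m\<close>. An edge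
  of \<open>G\<close> at a noncore \<open>a\<close> is no such pair, since otherwise
  \<open>a\<close> would be adjacent to all the rest of \<open>A\<close> and hence core. Of two
  edges at one core vertex, at most one is such a pair.\<close>

lemma locally_covered_meets:
  assumes "locally_covered A N" "N \<subseteq> edges G" "H \<in> Kp2s p G" "verts H = A"
  shows "\<exists>e\<in>edges H. e \<in> N"
proof -
  obtain m where m: "pairing A m" "H = pair_graph A m" "edges H \<subseteq> edges G"
    using Kp2s_E[OF assms(3)] assms(4) by metis
  have iff: "{x, y} \<in> edges H \<longleftrightarrow> x \<in> A \<and> y \<in> A \<and> x \<noteq> y \<and> y \<noteq> m x" for x y
    by (simp add: m(2) pair_graph_edge_iff[OF m(1)])
  from assms(1) consider
    a b where "a \<in> A" "a \<notin> core t G A" "b \<in> A" "{a, b} \<in> N" |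
    b x y where "b \<in> core t G A" "x \<noteq> y" "{b, x} \<in> N" "{b, y} \<in> N"
    by (auto simp: locally_covered_def)
  then show ?thesis
  proof cases
    case 1
    have "b \<noteq> m a"
    proof
      assume b: "b = m a"
      have "{a, u} \<in> edges G" if "u \<in> A" "u \<noteq> a" for u
        using that 1 assms(2) iff[of a u] m(3) b by (cases "u = b") auto
      then show False using 1 mateD[OF dense \<open>a \<in> A\<close>] by (auto simp: in_core_iff[OF dense])
    qed
    then have "{a, b} \<in> edges H" using 1 iff assms(2) edge_neq by blast
    then show ?thesis using 1 by blast
  next
    case 2
    have "z \<in> A" "b \<in> A" "b \<noteq> z" if "{b, z} \<in> N" for z
      using that assms(2) core_neighbor[OF dense 2(1)] core_subset[OF dense] 2(1) edge_neq by blast+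
    then have "{b, x} \<in> edges H \<or> {b, y} \<in> edges H" using iff 2 by metis
    then show ?thesis using 2 by blast
  qed
qed

text \<open>The common test for all exchanges. A \<open>K\<^sup>p\<^sub>2\<close> disjoint from
  \<open>A\<close> keeps its edge of \<open>N\<close> because only edges inside \<open>A\<close>
  change; any other one lives exactly on \<open>A\<close>, where \<open>local\<close> applies. The
  premise \<open>touched\<close> preserves the degree condition.\<close>

lemma minimal_exchange:
  assumes min: "minimal N" and N': "N' \<subseteq> edges G"
    and agree: "\<And>e. \<not> e \<subseteq> A \<Longrightarrow> e \<in> N' \<longleftrightarrow> e \<in> N"
    and touched: "\<And>v u. v \<in> A \<Longrightarrow> {v, u} \<in> N \<Longrightarrow> \<exists>u. {v, u} \<in> N'"
    and local: "locally_covered A N'"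
    and weight: "sum w N' \<le> sum w N"
  shows "minimal N'"
proof -
  have cov: "covering N"
    and least: "\<And>N''. covering N'' \<Longrightarrow> sum w N \<le> sum w N''"
    using min by (auto simp: min_weight_Kp2_covering_co_t_matching_def)
  have "covering N'"
    unfolding covering_iff
  proof (intro conjI ballI impI notI)
    fix v assume v: "v \<in> verts G" "degree (edges G) v = t + 1"
    then obtain u where u: "{v, u} \<in> N" using cov by (auto simp: covering_iff)
    then show "\<exists>u. {v, u} \<in> N'"
      using touched agree[of "{v, u}"] by (cases "v \<in> A") auto
  next
    assume "\<exists>H\<in>Kp2s p G. edges H \<subseteq> edges G - N'"
    then obtain H where H: "H \<in> Kp2s p G" "edges H \<subseteq> edges G - N'" by blast
    show False
    proof (cases "verts H \<inter> A = {}")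
      case True
      obtain e where e: "e \<in> edges H" "e \<in> N"
        using cov H unfolding covering_iff by blast
      then have "e \<subseteq> verts H" "card e = 2"
        using H edge_card by (auto simp: Kp2s_def subgraph_def)
      then have "\<not> e \<subseteq> A" using True by (auto simp: card_2_iff)
      then show False using agree e H by blast
    next
      case False
      then show False
        using locally_covered_meets[OF local N' H(1)] Kp2_meets_dense[OF dense H(1)] H(2) by blast
    qed
  qed (rule N')
  then show ?thesis
    using least weight by (force simp: min_weight_Kp2_covering_co_t_matching_def)
qed

end

subsection \<open>Exchange arguments\<close>

text \<open>The disjuncts are the configurations that a dense gadget can replace exactly. In the
  last one, \<open>{x, y} \<notin> N\<close> leaves that edge free to be inserted in exchange for
  the two edges at the center.\<close>

definition normal :: "'a set \<Rightarrow> 'a set set \<Rightarrow> bool" where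
  "normal A N \<longleftrightarrow>
     (\<exists>a\<in>A - core t G A. \<exists>b\<in>A - core t G A. {a, b} \<in> N) \<or>
     (\<exists>a\<in>A - core t G A. {a, c A} \<in> N) \<or>
     (\<exists>x\<in>core t G A. \<exists>y\<in>core t G A. x \<noteq> y \<and> {c A, x} \<in> N \<and> {c A, y} \<in> N \<and> {x, y} \<notin> N)"

context
  fixes N
  assumes min: "minimal N"
begin

lemma minimal_edges: "N \<subseteq> edges G" and minimal_finite: "finite N" and minimal_covering: "covering N"
proof -
  show "covering N" using min by (simp add: min_weight_Kp2_covering_co_t_matching_def)
  then show "N \<subseteq> edges G" by (simp add: covering_iff)
  then show "finite N" using finite_edges by (rule finite_subset)
qed

lemma minimal_neq: "{x, y} \<in> N \<Longrightarrow> x \<noteq> y"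
  using minimal_edges edge_neq by blast

end

context
  fixes A
  assumes dense: "dense p G A"
begin

lemma center_in_core: "c A \<in> core t G A"
  and center_least: "b \<in> core t G A \<Longrightarrow> pot A (c A) \<le> pot A b"
  using center dense by (auto simp: is_center_def)

lemma center_in: "c A \<in> A"
  using center_in_core core_subset[OF dense] by blast

end

context
  fixes A N
  assumes dense: "dense p G A" and min: "minimal N"
begin

text \<open>The weight changes by \<open>pot A (c A) - pot A b\<close>, which is at most 0. The edge
  \<open>{b, b'}\<close> keeps \<open>b\<close> touched. Local covering is a premise because it
  holds for different reasons in the two uses.\<close>

lemma move_to_center:
  assumes b: "b \<in> core t G A" and y: "{b, y} \<in> N" "{c A, y} \<notin> N" "y \<noteq> c A"
    and b': "b' \<noteq> y" "{b, b'} \<in> N"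
    and local: "locally_covered A (insert {c A, y} (N - {{b, y}}))"
  shows "minimal (insert {c A, y} (N - {{b, y}}))" (is "minimal ?N'")
proof (rule minimal_exchange[OF dense min])
  have yA: "y \<in> A" using core_neighbor[OF dense b] y(1) minimal_edges[OF min] by blast
  have bA: "b \<in> A" using b core_subset[OF dense] by blast
  have cy: "{c A, y} \<in> edges G" using core_adjacent[OF dense center_in_core[OF dense] yA y(3)] .
  show "?N' \<subseteq> edges G" using minimal_edges[OF min] cy by auto
  show "e \<in> ?N' \<longleftrightarrow> e \<in> N" if "\<not> e \<subseteq> A" for e
    using that yA bA center_in[OF dense] by auto
  show "\<exists>u. {v, u} \<in> ?N'" if "v \<in> A" "{v, u} \<in> N" for v u
  proof (cases "{v, u} = {b, y}")
    case True
    then consider "v = b" | "v = y" by (auto simp: doubleton_eq_iff)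
    then show ?thesis
    proof cases
      case 1
      have "{v, b'} \<in> ?N'" using 1 b' minimal_neq[OF min y(1)] by (auto simp: doubleton_eq_iff)
      then show ?thesis by blast
    next
      case 2
      have "{v, c A} \<in> ?N'" using 2 by (simp add: insert_commute)
      then show ?thesis by blast
    qed
  next
    case False
    then have "{v, u} \<in> ?N'" using that(2) by blast
    then show ?thesis by blast
  qed
  have "sum w ?N' = sum w N - w {b, y} + w {c A, y}"
    by (rule sum_exchange[OF minimal_finite[OF min] y(1,2)])
  moreover have "w {b, y} = pot A b + pot A y"
    using pot[OF dense] y(1) minimal_edges[OF min] bA yA by blast
  moreover have "w {c A, y} = pot A (c A) + pot A y"
    using pot[OF dense] cy center_in[OF dense] yA by blast
  ultimately show "sum w ?N' \<le> sum w N" using center_least[OF dense b] by linarith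
qed (rule local)

text \<open>Meant for a \<open>b\<close> whose only edge in \<open>N\<close> is
  \<open>{a, b}\<close>: an edge at the center is opened too, so that \<open>b\<close> receives the
  partner \<open>d\<close>. The old and new pairs of edges have the same four ends, hence the same
  weight, and no vertex becomes untouched.\<close>

lemma swap_to_center:
  assumes a: "a \<in> A" "a \<notin> core t G A" and b: "b \<in> core t G A" "b \<noteq> c A"
    and ab: "{a, b} \<in> N" and cd: "{c A, d} \<in> N"
    and d: "d \<noteq> a" "d \<noteq> b"
    and new: "{a, c A} \<notin> N" "{b, d} \<notin> N"
  shows "minimal (insert {b, d} (insert {a, c A} (N - {{a, b}}) - {{c A, d}}))" (is "minimal ?N'")
proof (rule minimal_exchange[OF dense min])
  let ?N1 = "insert {a, c A} (N - {{a, b}})"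
  have dA: "d \<in> A" using core_neighbor[OF dense center_in_core[OF dense]] cd minimal_edges[OF min] by blast
  have bA: "b \<in> A" using b core_subset[OF dense] by blast
  have neq: "a \<noteq> c A" "a \<noteq> b" "d \<noteq> c A"
    using a b center_in_core[OF dense] minimal_neq[OF min cd] by auto
  have bd: "{b, d} \<in> edges G" using core_adjacent[OF dense b(1) dA d(2)] .
  have ac: "{a, c A} \<in> edges G"
    using core_adjacent[OF dense center_in_core[OF dense] a(1) neq(1)] by (simp add: insert_commute)
  show "?N' \<subseteq> edges G" using minimal_edges[OF min] ac bd by auto
  show "e \<in> ?N' \<longleftrightarrow> e \<in> N" if "\<not> e \<subseteq> A" for e
    using that a bA dA center_in[OF dense] by auto
  show "\<exists>u. {v, u} \<in> ?N'" if "v \<in> A" "{v, u} \<in> N" for v u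
  proof (cases "{v, u} = {a, b} \<or> {v, u} = {c A, d}")
    case True
    then consider "v = a" | "v = b" | "v = c A" | "v = d" by (auto simp: doubleton_eq_iff)
    moreover have "{a, c A} \<in> ?N'" "{b, d} \<in> ?N'"
      using neq d by (auto simp: doubleton_eq_iff)
    ultimately show ?thesis by cases (auto simp: insert_commute intro: exI[of _ "a"] exI[of _ b] exI[of _ d] exI[of _ "c A"])
  next
    case False
    then have "{v, u} \<in> ?N'" using that(2) by blast
    then show ?thesis by blast
  qed
  have "{a, c A} \<in> ?N'" using neq d by (auto simp: doubleton_eq_iff)
  then show "locally_covered A ?N'" using a center_in[OF dense] unfolding locally_covered_def by blast
  have "sum w ?N1 = sum w N - w {a, b} + w {a, c A}"
    by (rule sum_exchange[OF minimal_finite[OF min] ab new(1)])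
  moreover have "sum w ?N' = sum w ?N1 - w {c A, d} + w {b, d}"
  proof (rule sum_exchange)
    show "finite ?N1" using minimal_finite[OF min] by simp
    show "{c A, d} \<in> ?N1" using cd neq b by (auto simp: doubleton_eq_iff)
    show "{b, d} \<notin> ?N1" using new neq b by (auto simp: doubleton_eq_iff)
  qed
  moreover have "w {a, b} = pot A a + pot A b" "w {c A, d} = pot A (c A) + pot A d"
    using pot[OF dense] ab cd minimal_edges[OF min] a bA dA center_in[OF dense] by blast+
  moreover have "w {a, c A} = pot A a + pot A (c A)" "w {b, d} = pot A b + pot A d"
    using pot[OF dense] ac bd a bA dA center_in[OF dense] by blast+
  ultimately show "sum w ?N' \<le> sum w N" by linarith
qed

text \<open>The edges at the center keep \<open>x\<close> and \<open>y\<close> touched and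
  \<open>A\<close> locally covered. Deletion does not raise the weight because \<open>w\<close> is
  nonnegative.\<close>

lemma drop_triangle:
  assumes xy: "x \<in> core t G A" "y \<in> core t G A" "x \<noteq> y"
    and N: "{c A, x} \<in> N" "{c A, y} \<in> N" "{x, y} \<in> N"
  shows "minimal (N - {{x, y}})" (is "minimal ?N'")
proof (rule minimal_exchange[OF dense min])
  have A: "x \<in> A" "y \<in> A" using xy core_subset[OF dense] by auto
  have neq: "c A \<noteq> x" "c A \<noteq> y" using N minimal_neq[OF min] by auto
  have cN: "{c A, x} \<in> ?N'" "{c A, y} \<in> ?N'" using N neq by (auto simp: doubleton_eq_iff)
  show "?N' \<subseteq> edges G" using minimal_edges[OF min] by auto
  show "e \<in> ?N' \<longleftrightarrow> e \<in> N" if "\<not> e \<subseteq> A" for e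
    using that A by auto
  show "\<exists>u. {v, u} \<in> ?N'" if "v \<in> A" "{v, u} \<in> N" for v u
  proof (cases "{v, u} = {x, y}")
    case True
    then have "{v, c A} \<in> ?N'" using cN by (auto simp: doubleton_eq_iff insert_commute)
    then show ?thesis by blast
  next
    case False
    then have "{v, u} \<in> ?N'" using that(2) by blast
    then show ?thesis by blast
  qed
  show "locally_covered A ?N'"
    by (rule locally_covered_coreI[OF center_in_core[OF dense] cN xy(3)])
  have "0 \<le> w {x, y}" using w_nonneg N minimal_edges[OF min] by auto
  then show "sum w ?N' \<le> sum w N"
    using N(3) minimal_finite[OF min] by (simp add: sum_diff1)
qed

end

text \<open>A noncore \<open>x\<close> or \<open>y\<close> gives an edge from a noncore vertex to
  the center. If both are core, the last disjunct of \<open>normal\<close> holds, after removal of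
  \<open>{x, y}\<close> if it is present.\<close>

lemma normalize_two_at_center:
  assumes dense: "dense p G A" and min: "minimal N"
    and xy: "{c A, x} \<in> N" "{c A, y} \<in> N" "x \<noteq> y"
  shows "\<exists>N'. minimal N' \<and> (\<forall>e. \<not> e \<subseteq> A \<longrightarrow> (e \<in> N' \<longleftrightarrow> e \<in> N)) \<and> normal A N'"
proof -
  have A: "x \<in> A" "y \<in> A"
    using xy core_neighbor[OF dense center_in_core[OF dense]] minimal_edges[OF min] by auto
  show ?thesis
  proof (cases "x \<in> core t G A \<and> y \<in> core t G A \<and> {x, y} \<in> N")
    case True
    have "c A \<noteq> x" "c A \<noteq> y" using xy minimal_neq[OF min] by auto
    then have "{c A, x} \<in> N - {{x, y}}" "{c A, y} \<in> N - {{x, y}}"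
      using xy by (auto simp: doubleton_eq_iff)
    then have "normal A (N - {{x, y}})"
      using True xy(3) unfolding normal_def by blast
    then show ?thesis
      using drop_triangle[OF dense min, of x y] True xy A by (intro exI[of _ "N - {{x, y}}"]) auto
  next
    case False
    moreover have "{x, c A} \<in> N" "{y, c A} \<in> N" using xy by (simp_all add: insert_commute)
    ultimately have "normal A N" using xy A unfolding normal_def by blast
    then show ?thesis using min by auto
  qed
qed

text \<open>Local covering leaves two situations: an edge at a noncore vertex is redirected to the
  center, or two edges at a core vertex are used to give the center two edges.\<close>

lemma normalize:
  assumes dense: "dense p G A" and min: "minimal N"
  shows "\<exists>N'. minimal N' \<and> (\<forall>e. \<not> e \<subseteq> A \<longrightarrow> (e \<in> N' \<longleftrightarrow> e \<in> N)) \<and> normal A N'"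
    (is "\<exists>N'. ?good N'")
proof (cases "normal A N")
  case True
  then show ?thesis using min by blast
next
  case not_normal: False
  note c_core = center_in_core[OF dense]
  have c_neighbor: "x \<in> A" if "{c A, x} \<in> N" for x
    using core_neighbor[OF dense c_core] that minimal_edges[OF min] by blast
  \<comment> \<open>The center is a core vertex and hence touched by \<open>N\<close>.\<close>
  obtain d where d: "{c A, d} \<in> N"
    using core_covered[OF dense minimal_covering[OF min] c_core] by blast
  have "d \<noteq> c A" using minimal_neq[OF min d] by simp
  from covering_imp_locally_covered[OF dense minimal_covering[OF min]]
  consider a b where "a \<in> A" "a \<notin> core t G A" "b \<in> A" "{a, b} \<in> N" |
    b x y where "b \<in> core t G A" "x \<noteq> y" "{b, x} \<in> N" "{b, y} \<in> N"
      "\<forall>a\<in>A - core t G A. \<forall>b\<in>A. {a, b} \<notin> N"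
    unfolding locally_covered_def by blast
  then show ?thesis
  proof cases
    case 1
    \<comment> \<open>Failure of \<open>normal\<close> excludes a noncore \<open>b\<close> and an
      edge from \<open>a\<close> to the center.\<close>
    have b: "b \<in> core t G A" "b \<noteq> c A" using 1 not_normal by (auto simp: normal_def)
    have ac: "{a, c A} \<notin> N" "a \<noteq> c A" using 1 not_normal c_core by (auto simp: normal_def)
    show ?thesis
    proof (cases "\<exists>b'. b' \<noteq> a \<and> {b, b'} \<in> N")
      case True
      then obtain b' where b': "b' \<noteq> a" "{b, b'} \<in> N" by blast
      let ?N' = "insert {c A, a} (N - {{b, a}})"
      have in_N': "{a, c A} \<in> ?N'" by (simp add: insert_commute)
      have "minimal ?N'"
      proof (rule move_to_center[OF dense min b(1) _ _ ac(2) b'])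
        show "{b, a} \<in> N" "{c A, a} \<notin> N" using 1 ac by (simp_all add: insert_commute)
        show "locally_covered A ?N'"
          using in_N' 1 center_in[OF dense] unfolding locally_covered_def by blast
      qed
      moreover have "normal A ?N'" using in_N' 1 unfolding normal_def by blast
      moreover have "e \<in> ?N' \<longleftrightarrow> e \<in> N" if "\<not> e \<subseteq> A" for e
        using that 1 center_in[OF dense] by auto
      ultimately show ?thesis by blast
    next
      case False
      \<comment> \<open>Here \<open>a\<close> is the only partner of \<open>b\<close>, so moving
        \<open>{b, a}\<close> would leave \<open>b\<close> untouched; swapping with
        \<open>{c A, d}\<close> avoids this.\<close>
      have "d \<noteq> a" using d ac by (auto simp: insert_commute)
      have "d \<noteq> b" using False d ac(2) by (auto simp: insert_commute)
      have bd: "{b, d} \<notin> N" using False \<open>d \<noteq> a\<close> by blast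
      let ?N' = "insert {b, d} (insert {a, c A} (N - {{a, b}}) - {{c A, d}})"
      have in_N': "{a, c A} \<in> ?N'"
        using \<open>d \<noteq> a\<close> ac(2) by (auto simp: doubleton_eq_iff)
      have "minimal ?N'"
        by (rule swap_to_center[OF dense min 1(1,2) b 1(4) d \<open>d \<noteq> a\<close> \<open>d \<noteq> b\<close> ac(1) bd])
      moreover have "normal A ?N'" using in_N' 1 unfolding normal_def by blast
      moreover have "e \<in> ?N' \<longleftrightarrow> e \<in> N" if "\<not> e \<subseteq> A" for e
        using that 1 center_in[OF dense] c_neighbor[OF d] by auto
      ultimately show ?thesis by blast
    qed
  next
    case 2
    show ?thesis
    proof (cases "\<exists>z. z \<noteq> d \<and> {c A, z} \<in> N")
      case True
      then show ?thesis using normalize_two_at_center[OF dense min] d by blast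
    next
      case False
      have b: "b \<noteq> c A" using 2(2-4) False by metis
      \<comment> \<open>The edge to be moved must end neither in the center nor in \<open>d\<close>,
        so that the center gains a second neighbor. If \<open>{b, c A}\<close> is in
        \<open>N\<close>, then \<open>d = b\<close> and any other neighbor of \<open>b\<close>
        serves; otherwise one of the two given neighbors differs from \<open>d\<close>.\<close>
      have "\<exists>y b'. {b, y} \<in> N \<and> y \<noteq> c A \<and> y \<noteq> d \<and> b' \<noteq> y \<and> {b, b'} \<in> N"
      proof (cases "{b, c A} \<in> N")
        case True
        then have "d = b" using False by (auto simp: insert_commute)
        then show ?thesis using 2 True minimal_neq[OF min] by metis
      next
        case False
        then show ?thesis using 2 by metis
      qed
      then obtain y b' where y: "{b, y} \<in> N" "y \<noteq> c A" "y \<noteq> d" "b' \<noteq> y" "{b, b'} \<in> N"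
        by blast
      have cy: "{c A, y} \<notin> N" using False y by blast
      define N1 where "N1 = insert {c A, y} (N - {{b, y}})"
      have bA: "b \<in> A" "y \<in> A"
        using 2(1) y(1) core_neighbor[OF dense 2(1)] core_subset[OF dense] minimal_edges[OF min]
        by blast+
      have two: "{c A, y} \<in> N1" "{c A, d} \<in> N1"
        using d b y by (auto simp: N1_def doubleton_eq_iff)
      have min': "minimal N1"
        unfolding N1_def
      proof (rule move_to_center[OF dense min 2(1) y(1) cy y(2,4,5)])
        show "locally_covered A (insert {c A, y} (N - {{b, y}}))"
          unfolding N1_def[symmetric] by (rule locally_covered_coreI[OF c_core two y(3)])
      qed
      have agree: "e \<in> N1 \<longleftrightarrow> e \<in> N" if "\<not> e \<subseteq> A" for e
        using that bA center_in[OF dense] by (auto simp: N1_def)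
      show ?thesis
        using normalize_two_at_center[OF dense min' two y(3)] agree by blast
    qed
  qed
qed

lemma normal_cong:
  assumes "dense p G A" "\<And>e. e \<subseteq> A \<Longrightarrow> e \<in> N' \<longleftrightarrow> e \<in> N"
  shows "normal A N' \<longleftrightarrow> normal A N"
proof -
  have A: "c A \<in> A" "\<And>x. x \<in> core t G A \<Longrightarrow> x \<in> A"
    using center_in[OF assms(1)] core_subset[OF assms(1)] by auto
  have "{a, b} \<in> N' \<longleftrightarrow> {a, b} \<in> N" if "a \<in> A" "b \<in> A" for a b
    using that assms(2) by simp
  then show ?thesis
    unfolding normal_def by (intro disj_cong bex_cong refl conj_cong) (simp_all add: A)
qed

text \<open>Different dense sets are disjoint, so normalizing one leaves the edges inside the others
  unchanged.\<close>

lemma normalize_all: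
  assumes "finite \<D>" "\<And>A. A \<in> \<D> \<Longrightarrow> dense p G A" "minimal N"
  shows "\<exists>N'. minimal N' \<and> (\<forall>A\<in>\<D>. normal A N')"
  using assms
proof (induction \<D>)
  case (insert A \<D>)
  then obtain N1 where N1: "minimal N1" "\<forall>A\<in>\<D>. normal A N1" by auto
  obtain N2 where N2: "minimal N2" "\<And>e. \<not> e \<subseteq> A \<Longrightarrow> e \<in> N2 \<longleftrightarrow> e \<in> N1" "normal A N2"
    using normalize[OF _ N1(1)] insert.prems by blast
  have "normal B N2" if "B \<in> \<D>" for B
  proof -
    have B: "dense p G B" "A \<inter> B = {}"
      using that insert dense_disjoint_dense[of A B] by auto
    \<comment> \<open>Disjoint sets still share the empty subset, so edges, which have two elements,
      are separated from nonedges, which lie in neither \<open>N1\<close> nor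
      \<open>N2\<close>.\<close>
    have "e \<in> N2 \<longleftrightarrow> e \<in> N1" if "e \<subseteq> B" for e
    proof (cases "e \<in> edges G")
      case True
      then have "\<not> e \<subseteq> A" using edge_card that B by (fastforce simp: card_2_iff)
      then show ?thesis using N2(2) by simp
    next
      case False
      then show ?thesis using minimal_edges[OF N1(1)] minimal_edges[OF N2(1)] by blast
    qed
    then show ?thesis using normal_cong[OF B(1), of N2 N1] N1(2) \<open>B \<in> \<D>\<close> by simp
  qed
  then show ?case using N2 by auto
qed auto

end

subsection \<open>Trading edges for gadgets\<close>

lemma degree_insert:
  assumes "finite F" "e \<notin> F"
  shows "degree (insert e F) v = (if v \<in> e then 1 else 0) + degree F v"
proof -
  have "{f \<in> insert e F. v \<in> f} = (if v \<in> e then insert e {f \<in> F. v \<in> f} else {f \<in> F. v \<in> f})"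
    by auto
  then show ?thesis using assms by (simp add: degree_def)
qed

lemma degree_empty [simp]: "degree {} v = 0"
  by (simp add: degree_def)

text \<open>Depends only on the incidence map, so parts of a matching can be counted before the
  whole multigraph is assembled. On \<open>gadget_graph\<close> it coincides with
  \<open>mdegree\<close>.\<close>

definition gdegree :: "('a set \<Rightarrow> 'a) \<Rightarrow> 'a gedge set \<Rightarrow> 'a gvertex \<Rightarrow> nat" where
  "gdegree c P x = card {e\<in>P. x \<in> gends c e}"

lemma gdegree_empty [simp]: "gdegree c {} x = 0"
  by (simp add: gdegree_def)

lemma gdegree_insert:
  assumes "finite P" "e \<notin> P"
  shows "gdegree c (insert e P) x = (if x \<in> gends c e then 1 else 0) + gdegree c P x"
proof -
  have "{f \<in> insert e P. x \<in> gends c f}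
      = (if x \<in> gends c e then insert e {f \<in> P. x \<in> gends c f} else {f \<in> P. x \<in> gends c f})"
    by auto
  then show ?thesis using assms by (simp add: gdegree_def)
qed

lemma gdegree_Un_disjoint:
  assumes "finite P" "finite Q" "P \<inter> Q = {}"
  shows "gdegree c (P \<union> Q) x = gdegree c P x + gdegree c Q x"
proof -
  have "{e \<in> P \<union> Q. x \<in> gends c e} = {e \<in> P. x \<in> gends c e} \<union> {e \<in> Q. x \<in> gends c e}" by auto
  then show ?thesis
    using assms unfolding gdegree_def by (simp add: card_Un_disjoint disjoint_iff)
qed

lemma gdegree_eq_0: "(\<And>e. e \<in> P \<Longrightarrow> x \<notin> gends c e) \<Longrightarrow> gdegree c P x = 0"
  by (auto simp: gdegree_def card_eq_0_iff)

lemma gdegree_OrigE: "gdegree c (OrigE ` F) (Orig v) = degree F v"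
proof -
  have "Orig v \<in> gends c (OrigE e) \<longleftrightarrow> v \<in> e" for e by auto
  then have "{e \<in> OrigE ` F. Orig v \<in> gends c e} = OrigE ` {e \<in> F. v \<in> e}" by blast
  then show ?thesis by (simp add: gdegree_def degree_def card_image inj_on_def)
qed

lemma gdegree_ProbUZ:
  "gdegree c (ProbUZ H ` S) x =
     (case x of ProbU H' X \<Rightarrow> if H' = H \<and> X \<in> S then 1 else 0 | ProbZ H' \<Rightarrow> if H' = H then card S else 0
      | _ \<Rightarrow> 0)"
proof -
  have "{e \<in> ProbUZ H ` S. x \<in> gends c e} = (case x of
      ProbU H' X \<Rightarrow> if H' = H \<and> X \<in> S then {ProbUZ H X} else {}
      | ProbZ H' \<Rightarrow> if H' = H then ProbUZ H ` S else {} | _ \<Rightarrow> {})"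
    by (cases x) auto
  then show ?thesis by (auto simp: gdegree_def card_image inj_on_def split: gvertex.split)
qed

lemma gdegree_DenseUZ:
  "gdegree c (DenseUZ A ` S) x =
     (case x of DenseU B X \<Rightarrow> if B = A \<and> X \<in> S then 1 else 0 | DenseZ B \<Rightarrow> if B = A then card S else 0
      | _ \<Rightarrow> 0)"
proof -
  have "{e \<in> DenseUZ A ` S. x \<in> gends c e} = (case x of
      DenseU B X \<Rightarrow> if B = A \<and> X \<in> S then {DenseUZ A X} else {}
      | DenseZ B \<Rightarrow> if B = A then DenseUZ A ` S else {} | _ \<Rightarrow> {})"
    by (cases x) auto
  then show ?thesis by (auto simp: gdegree_def card_image inj_on_def split: gvertex.split)
qed

context kp2_instance
begin

text \<open>
  The edges \<open>R\<close> of \<open>N\<close> are traded for the edges \<open>D\<close> of \<open>G\<close> and the edges \<open>P\<close> of the gadget,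
  without changing the weight or any degree in \<open>G\<close>.
\<close>

definition gadget_solved ::
    "'a set set \<Rightarrow> 'a set \<Rightarrow> 'a gedge set \<Rightarrow> 'a gvertex set \<Rightarrow> bool" where
  "gadget_solved N A L X \<longleftrightarrow>
     (\<exists>R D P. R \<subseteq> N \<and> D \<subseteq> edges G - N \<and> (\<forall>e\<in>R \<union> D. e \<subseteq> A) \<and> P \<subseteq> L \<and> finite P \<and>
        sum w R = sum w D + sum (gadget_weight G w c) P \<and>
        (\<forall>v. degree R v = degree D v + gdegree c P (Orig v)) \<and>
        (\<forall>x\<in>X. gadget_lower p t G x \<le> gdegree c P x \<and> gdegree c P x \<le> gadget_upper p t G x))"

text \<open>Induction on the index set, one trade at a time. The last conjunct strengthens the
  induction: away from the sets already treated the matching still agrees with \<open>N\<close>, so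
  the next trade finds \<open>R\<close> present and \<open>D\<close> absent.\<close>

lemma combine_gadgets:
  fixes A :: "'i \<Rightarrow> 'a set" and L :: "'i \<Rightarrow> 'a gedge set" and X :: "'i \<Rightarrow> 'a gvertex set"
  assumes N: "N \<subseteq> edges G" and I: "finite I"
    and solved: "\<And>i. i \<in> I \<Longrightarrow> gadget_solved N (A i) (L i) (X i)"
    and A: "\<And>i j. i \<in> I \<Longrightarrow> j \<in> I \<Longrightarrow> i \<noteq> j \<Longrightarrow> A i \<inter> A j = {}"
    and L: "\<And>i j. i \<in> I \<Longrightarrow> j \<in> I \<Longrightarrow> i \<noteq> j \<Longrightarrow> L i \<inter> L j = {}"
    and LO: "\<And>i e. i \<in> I \<Longrightarrow> OrigE e \<notin> L i"
    and XO: "\<And>i v. i \<in> I \<Longrightarrow> Orig v \<notin> X i"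
    and LX: "\<And>i j e x. i \<in> I \<Longrightarrow> j \<in> I \<Longrightarrow> i \<noteq> j \<Longrightarrow> e \<in> L i \<Longrightarrow> x \<in> X j \<Longrightarrow> x \<notin> gends c e"
  shows "\<exists>M. M \<subseteq> OrigE ` edges G \<union> (\<Union>i\<in>I. L i) \<and> finite M \<and>
      sum (gadget_weight G w c) M = sum w N \<and>
      (\<forall>v. gdegree c M (Orig v) = degree N v) \<and>
      (\<forall>i\<in>I. \<forall>x\<in>X i. gadget_lower p t G x \<le> gdegree c M x \<and> gdegree c M x \<le> gadget_upper p t G x) \<and>
      (\<forall>e. (\<forall>i\<in>I. \<not> e \<subseteq> A i) \<longrightarrow> (OrigE e \<in> M \<longleftrightarrow> e \<in> N))"
  using I solved A L LO XO LX
proof (induction I)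
  case empty
  have "finite N" using N finite_edges by (rule finite_subset)
  moreover have "sum (gadget_weight G w c) (OrigE ` N) = sum w N"
    by (simp add: sum.reindex inj_on_def)
  ultimately show ?case
    using N by (intro exI[of _ "OrigE ` N"]) (auto simp: gdegree_OrigE)
next
  case (insert i I)
  let ?w = "gadget_weight G w c"
  have "\<exists>M. M \<subseteq> OrigE ` edges G \<union> (\<Union>i\<in>I. L i) \<and> finite M \<and>
      sum ?w M = sum w N \<and>
      (\<forall>v. gdegree c M (Orig v) = degree N v) \<and>
      (\<forall>i\<in>I. \<forall>x\<in>X i. gadget_lower p t G x \<le> gdegree c M x \<and> gdegree c M x \<le> gadget_upper p t G x) \<and>
      (\<forall>e. (\<forall>i\<in>I. \<not> e \<subseteq> A i) \<longrightarrow> (OrigE e \<in> M \<longleftrightarrow> e \<in> N))"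
    by (rule insert.IH; rule insert.prems; blast)
  then obtain M where M: "M \<subseteq> OrigE ` edges G \<union> (\<Union>i\<in>I. L i)" "finite M"
    and M_weight: "sum ?w M = sum w N"
    and M_deg: "\<forall>v. gdegree c M (Orig v) = degree N v"
    and M_int: "\<forall>j\<in>I. \<forall>x\<in>X j.
      gadget_lower p t G x \<le> gdegree c M x \<and> gdegree c M x \<le> gadget_upper p t G x"
    and M_orig: "\<forall>e. (\<forall>j\<in>I. \<not> e \<subseteq> A j) \<longrightarrow> (OrigE e \<in> M \<longleftrightarrow> e \<in> N)"
    by (elim exE conjE) (rule that)
  obtain R D P where RDP: "R \<subseteq> N" "D \<subseteq> edges G - N" "\<forall>e\<in>R \<union> D. e \<subseteq> A i" "P \<subseteq> L i" "finite P"
    and weight: "sum w R = sum w D + sum ?w P"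
    and deg: "\<forall>v. degree R v = degree D v + gdegree c P (Orig v)"
    and int: "\<forall>x\<in>X i.
      gadget_lower p t G x \<le> gdegree c P x \<and> gdegree c P x \<le> gadget_upper p t G x"
    using insert.prems(1)[OF insertI1] unfolding gadget_solved_def
    by (elim exE conjE) (rule that)
  have sub: "R \<subseteq> edges G" "D \<subseteq> edges G" using RDP N by auto
  have fin: "finite R" "finite D" using sub finite_edges finite_subset by auto
  \<comment> \<open>Disjoint sets have only the empty subset in common, so an edge inside
    \<open>A i\<close> was not affected by earlier trades.\<close>
  have off: "\<not> e \<subseteq> A j" if "e \<in> R \<union> D" "j \<in> I" for e j
  proof
    assume "e \<subseteq> A j"
    moreover have "i \<noteq> j" using insert.hyps that by auto
    then have "A i \<inter> A j = {}" using insert.prems(2)[of i j] that by blast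
    ultimately have "e = {}" using RDP(3) that by blast
    then show False using edge_card[of e] sub that by auto
  qed
  have RM: "OrigE ` R \<subseteq> M" using M_orig off RDP(1) by auto
  have DM: "M \<inter> OrigE ` D = {}" using M_orig off RDP(2) by auto
  have P_M: "P \<inter> M = {}"
  proof -
    have "L i \<inter> L j = {}" if "j \<in> I" for j
      using insert.prems(3)[of i j] insert.hyps that by blast
    then show ?thesis using M(1) RDP(4) insert.prems(4)[of i] by blast
  qed
  have PD: "P \<inter> OrigE ` D = {}" using RDP(4) insert.prems(4)[of i] by blast
  define M0 where "M0 = M - OrigE ` R"
  define M' where "M' = M0 \<union> (OrigE ` D \<union> P)"
  have M: "M = M0 \<union> OrigE ` R" "M0 \<inter> OrigE ` R = {}" "finite M0"
    using RM M(2) by (auto simp: M0_def)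
  have disj: "M0 \<inter> (OrigE ` D \<union> P) = {}" "OrigE ` D \<inter> P = {}"
    using DM P_M PD by (auto simp: M0_def)
  have M'_deg: "gdegree c M' x = gdegree c M0 x + (gdegree c (OrigE ` D) x + gdegree c P x)" for x
    unfolding M'_def using M(3) fin RDP(5) disj by (simp add: gdegree_Un_disjoint)
  have M_deg_eq: "gdegree c M x = gdegree c M0 x + gdegree c (OrigE ` R) x" for x
    unfolding M(1) using M(2,3) fin by (simp add: gdegree_Un_disjoint)
  \<comment> \<open>Original edges never end in an inner vertex of a gadget, so exchanging them does
    not change inner degrees.\<close>
  have orig0: "gdegree c (OrigE ` F) x = 0" if "j \<in> insert i I" "x \<in> X j" for x j F
    by (rule gdegree_eq_0) (use that insert.prems(5)[OF that(1)] in auto)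
  show ?case
  proof (intro exI[of _ M'] conjI allI ballI impI)
    show "M' \<subseteq> OrigE ` edges G \<union> (\<Union>i\<in>insert i I. L i)"
      using \<open>M \<subseteq> OrigE ` edges G \<union> (\<Union>i\<in>I. L i)\<close> sub RDP(4) by (auto simp: M'_def M0_def)
    show "finite M'" using M(3) fin RDP(5) by (simp add: M'_def)
    have orig_sum: "sum ?w (OrigE ` F) = sum w F" for F
      by (simp add: sum.reindex inj_on_def)
    have "sum ?w M' = sum ?w M0 + (sum w D + sum ?w P)"
      unfolding M'_def using M(3) fin RDP(5) disj by (simp add: sum.union_disjoint orig_sum)
    moreover have "sum ?w M = sum ?w M0 + sum w R"
      unfolding M(1) using M(2,3) fin by (simp add: sum.union_disjoint orig_sum)
    ultimately show "sum ?w M' = sum w N" using M_weight weight by linarith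
    show "gdegree c M' (Orig v) = degree N v" for v
      using M_deg[rule_format, of v] deg[rule_format, of v] M_deg_eq[of "Orig v"] M'_deg[of "Orig v"]
      by (simp add: gdegree_OrigE)
    show "OrigE e \<in> M' \<longleftrightarrow> e \<in> N" if "\<forall>j\<in>insert i I. \<not> e \<subseteq> A j" for e
    proof -
      have "OrigE e \<in> M' \<longleftrightarrow> OrigE e \<in> M"
        using that RDP(3,4) insert.prems(4)[of i] by (auto simp: M'_def M0_def)
      moreover have "\<forall>j\<in>I. \<not> e \<subseteq> A j" using that by blast
      ultimately show ?thesis using M_orig by blast
    qed
  next
    fix j x assume j: "j \<in> insert i I" "x \<in> X j"
    have "gdegree c M' x = gdegree c M x + gdegree c P x"
      using M'_deg[of x] M_deg_eq[of x] orig0[OF j] by simp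
    moreover have "gdegree c P x = 0" if "j \<noteq> i"
      by (rule gdegree_eq_0) (use insert.prems(6)[of i j] that j RDP(4) in blast)
    moreover have "gdegree c M x = 0" if "j = i"
    proof (rule gdegree_eq_0)
      fix e assume "e \<in> M"
      then consider f where "e = OrigE f" | k where "k \<in> I" "e \<in> L k"
        using \<open>M \<subseteq> OrigE ` edges G \<union> (\<Union>i\<in>I. L i)\<close> by blast
      then show "x \<notin> gends c e"
      proof cases
        case 1
        then show ?thesis using insert.prems(5)[OF j(1)] j(2) by auto
      next
        case 2
        then show ?thesis using insert.prems(6)[of k i e x] insert.hyps(2) that j by blast
      qed
    qed
    ultimately have *: "gdegree c M' x = (if j = i then gdegree c P x else gdegree c M x)"
      by auto
    show "gadget_lower p t G x \<le> gdegree c M' x"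
      using * int[rule_format, of x] M_int[rule_format, of j x] j by auto
    show "gdegree c M' x \<le> gadget_upper p t G x"
      using * int[rule_format, of x] M_int[rule_format, of j x] j by auto
  qed
qed

section \<open>Solving a single gadget\<close>

definition prob_edges :: "'a graph \<Rightarrow> 'a gedge set" where
  "prob_edges H = {ProbVU H v X | v X. X \<in> color_classes H \<and> v \<in> X}
     \<union> {ProbUZ H X | X. X \<in> color_classes H}"

definition prob_inner :: "'a graph \<Rightarrow> 'a gvertex set" where
  "prob_inner H = {ProbU H X | X. X \<in> color_classes H} \<union> {ProbZ H}"

definition dense_edges :: "'a set \<Rightarrow> 'a gedge set" where
  "dense_edges A = {DenseVU A v X | v X. X \<in> outer_classes p t G A \<and> v \<in> X}
     \<union> {DenseUZ A X | X. X \<in> outer_classes p t G A}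
     \<union> {DenseCU A i | i. True} \<union> {DenseUcZ A i | i. True}"

definition dense_inner :: "'a set \<Rightarrow> 'a gvertex set" where
  "dense_inner A = {DenseU A X | X. X \<in> outer_classes p t G A} \<union> {DenseC A, DenseZ A}"

text \<open>\<open>N\<close> contains an edge of \<open>H\<close>, whose ends lie in two different
  classes. It is traded for the half-edges from its ends, and the potential splits its weight
  accordingly. The remaining \<open>p - 2\<close> class vertices are joined to
  \<open>ProbZ H\<close>, which fills its capacity exactly.\<close>

lemma problematic_solved:
  assumes min: "minimal N" and H: "H \<in> problematic_Kp2s p G w"
  shows "gadget_solved N (verts H) (prob_edges H) (prob_inner H)"
proof -
  have K: "H \<in> Kp2s p G" using H by (simp add: problematic_Kp2s_def)
  then obtain m where m: "pairing (verts H) m" "finite (verts H)" "card (verts H) = 2 * p"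
    "H = pair_graph (verts H) m" "edges H \<subseteq> edges G"
    by (rule Kp2s_E)
  let ?C = "color_classes H"
  have C: "?C = (\<lambda>v. {v, m v}) ` verts H" using color_classes_pair_graph[OF m(1)] m(4) by simp
  have card_C: "card ?C = p" and fin_C: "finite ?C"
    using card_pairs[OF m(1,2)] m(2,3) by (simp_all add: C)
  obtain e where e: "e \<in> edges H" "e \<in> N"
    using minimal_covering[OF min] K m(5) unfolding covering_iff by blast
  then have "e \<in> edges (pair_graph (verts H) m)" using m(4) by simp
  then obtain a b where ab: "e = {a, b}" "a \<in> verts H" "b \<in> verts H" "a \<noteq> b" "b \<noteq> m a"
    by (rule pair_graph_edgeE)
  define X where "X = {a, m a}"
  define Y where "Y = {b, m b}"
  have XY: "X \<in> ?C" "Y \<in> ?C" "X \<noteq> Y" "a \<in> X" "b \<in> Y"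
    using ab pair_classes_distinct[OF m(1) ab(2-5)] by (auto simp: X_def Y_def C)
  have card_XY: "card (?C - {X, Y}) = p - 2"
    using XY card_C fin_C by (simp add: card_Diff_subset)
  define P where "P = insert (ProbVU H a X) (insert (ProbVU H b Y) (ProbUZ H ` (?C - {X, Y})))"
  have fresh: "ProbVU H a X \<notin> insert (ProbVU H b Y) (ProbUZ H ` (?C - {X, Y}))"
    "ProbVU H b Y \<notin> ProbUZ H ` (?C - {X, Y})"
    using ab by auto
  have deg: "gdegree c P x = (if x \<in> {Orig a, ProbU H X} then 1 else 0)
      + ((if x \<in> {Orig b, ProbU H Y} then 1 else 0) + gdegree c (ProbUZ H ` (?C - {X, Y})) x)" for x
    unfolding P_def using fresh fin_C by (simp add: gdegree_insert)
  have "w {a, b} = potential w H a + potential w H b"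
    using is_potential_Kp2[OF K] e ab by (simp add: is_potential_def)
  moreover have "sum (gadget_weight G w c) P = potential w H a + potential w H b"
    unfolding P_def using fresh fin_C by (simp add: sum.reindex inj_on_def)
  ultimately have weight: "sum w {{a, b}} = sum w {} + sum (gadget_weight G w c) P" by simp
  show ?thesis
    unfolding gadget_solved_def
  proof (rule exI[of _ "{{a, b}}"], rule exI[of _ "{}"], rule exI[of _ P], intro conjI allI ballI)
    show "P \<subseteq> prob_edges H" using XY by (auto simp: P_def prob_edges_def)
    show "degree {{a, b}} v = degree {} v + gdegree c P (Orig v)" for v
      using ab(4) by (simp add: deg degree_insert gdegree_ProbUZ)
    fix x assume "x \<in> prob_inner H"
    then consider Z where "x = ProbU H Z" "Z \<in> ?C" | "x = ProbZ H"
      unfolding prob_inner_def by blast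
    then have "gdegree c P x = gadget_lower p t G x \<and> gdegree c P x = gadget_upper p t G x"
    proof cases
      case 1
      then show ?thesis using XY(3) by (simp add: deg gdegree_ProbUZ)
    next
      case 2
      then show ?thesis by (simp add: deg gdegree_ProbUZ card_XY)
    qed
    then show "gadget_lower p t G x \<le> gdegree c P x" "gdegree c P x \<le> gadget_upper p t G x"
      by simp_all
  qed (use ab e fin_C weight in \<open>auto simp: P_def\<close>)
qed

text \<open>One trade for each disjunct of \<open>normal\<close>. In all of them
  \<open>DenseC A\<close> must reach degree 2 and \<open>DenseZ A\<close> the number of outer
  classes.\<close>

lemma dense_solved:
  assumes min: "minimal N" and dense: "dense p G A" and normal: "normal A N"
  shows "gadget_solved N A (dense_edges A) (dense_inner A)"
proof -
  let ?C = "outer_classes p t G A"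
  let ?w = "gadget_weight G w c"
  have fin: "finite ?C" using dense_finite[OF dense] by (simp add: outer_classes_eq[OF dense])
  note card_C = card_outer_classes[OF dense, symmetric]
  have E: "N \<subseteq> edges G" by (rule minimal_edges[OF min])
  have outer_class: "{v, mate A v} \<in> ?C" if "v \<in> A" "v \<notin> core t G A" for v
    using that by (auto simp: outer_classes_eq[OF dense])
  have UZ_weight: "sum ?w (DenseUZ A ` S) = 0" for S
    by (simp add: sum.reindex inj_on_def)
  have solvedI: "gadget_solved N A (dense_edges A) (dense_inner A)"
    if "R \<subseteq> N" "D \<subseteq> edges G - N" "\<And>e. e \<in> R \<union> D \<Longrightarrow> e \<subseteq> A" "P \<subseteq> dense_edges A" "finite P"
      "sum w R = sum w D + sum ?w P" "\<And>v. degree R v = degree D v + gdegree c P (Orig v)"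
      "\<And>X. X \<in> ?C \<Longrightarrow> gdegree c P (DenseU A X) = 1" "gdegree c P (DenseC A) = 2"
      "gdegree c P (DenseZ A) = card ?C"
    for R D P
    unfolding gadget_solved_def using that card_C
    by - (rule exI[of _ R], rule exI[of _ D], rule exI[of _ P], auto simp: dense_inner_def)
  from normal consider
    (outer) a b where "a \<in> A" "a \<notin> core t G A" "b \<in> A" "b \<notin> core t G A" "{a, b} \<in> N" |
    (mixed) a where "a \<in> A" "a \<notin> core t G A" "{a, c A} \<in> N" |
    (inner) x y where "x \<in> core t G A" "y \<in> core t G A" "x \<noteq> y" "{c A, x} \<in> N" "{c A, y} \<in> N" "{x, y} \<notin> N"
    unfolding normal_def by blast
  then show ?thesis
  proof cases
    case outer
    have ab: "a \<noteq> b" "b \<noteq> mate A a"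
      using outer E edge_neq outer_nonadjacent[OF dense outer(1,2)] by blast+
    define X where "X = {a, mate A a}"
    define Y where "Y = {b, mate A b}"
    have XY: "X \<in> ?C" "Y \<in> ?C" "X \<noteq> Y" "a \<in> X" "b \<in> Y"
      using outer_class outer pair_classes_distinct[OF mate[OF dense] outer(1,3) ab] by (auto simp: X_def Y_def)
    \<comment> \<open>Two outer classes exist, so the subtraction in the next count is not
      truncated.\<close>
    have "card {X, Y} \<le> card ?C" by (rule card_mono) (use fin XY in auto)
    then have card_XY: "card (?C - {X, Y}) + 2 = card ?C"
      using XY fin by (simp add: card_Diff_subset)
    let ?U = "DenseUZ A ` (?C - {X, Y})"
    \<comment> \<open>The class vertices of \<open>a\<close> and \<open>b\<close> take the
      half-edges; at \<open>DenseZ A\<close> they are replaced by the two parallel edges from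
      \<open>DenseC A\<close>.\<close>
    define P where "P = insert (DenseVU A a X) (insert (DenseVU A b Y)
      (insert (DenseUcZ A True) (insert (DenseUcZ A False) ?U)))"
    have fresh: "DenseVU A a X \<notin> insert (DenseVU A b Y) (insert (DenseUcZ A True) (insert (DenseUcZ A False) ?U))"
      "DenseVU A b Y \<notin> insert (DenseUcZ A True) (insert (DenseUcZ A False) ?U)"
      "DenseUcZ A True \<notin> insert (DenseUcZ A False) ?U" "DenseUcZ A False \<notin> ?U"
      using ab by auto
    have deg: "gdegree c P x = (if x \<in> {Orig a, DenseU A X} then 1 else 0)
        + ((if x \<in> {Orig b, DenseU A Y} then 1 else 0)
        + ((if x \<in> {DenseC A, DenseZ A} then 2 else 0) + gdegree c ?U x))" for x
      unfolding P_def using fresh fin by (simp add: gdegree_insert)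
    have "w {a, b} = pot A a + pot A b"
      using pot[OF dense] outer E by blast
    moreover have "sum ?w P = pot A a + pot A b"
      unfolding P_def using fresh fin by (simp add: UZ_weight)
    ultimately have weight: "sum w {{a, b}} = sum w {} + sum ?w P" by simp
    show ?thesis
    proof (rule solvedI[of "{{a, b}}" "{}" P])
      show "P \<subseteq> dense_edges A" using XY by (auto simp: P_def dense_edges_def)
      show "finite P" using fin by (simp add: P_def)
      show "degree {{a, b}} v = degree {} v + gdegree c P (Orig v)" for v
        using ab(1) by (simp add: deg degree_insert gdegree_DenseUZ)
      show "gdegree c P (DenseU A Z) = 1" if "Z \<in> ?C" for Z
        using that XY by (auto simp: deg gdegree_DenseUZ)
      show "gdegree c P (DenseC A) = 2" "gdegree c P (DenseZ A) = card ?C"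
        using card_XY by (simp_all add: deg gdegree_DenseUZ)
    qed (use outer weight in auto)
  next
    case mixed
    have a: "a \<noteq> c A" using mixed E edge_neq by blast
    define X where "X = {a, mate A a}"
    have X: "X \<in> ?C" "a \<in> X" using outer_class mixed by (auto simp: X_def)
    have card_X: "card (?C - {X}) + 1 = card ?C"
      using X fin card_gt_0_iff[of ?C] by (auto simp: card_Diff_singleton)
    let ?U = "DenseUZ A ` (?C - {X})"
    \<comment> \<open>The half-edge at the center enters \<open>DenseC A\<close>, which then sends
      only one edge to \<open>DenseZ A\<close>, in place of the class of \<open>a\<close>.\<close>
    define P where "P = insert (DenseVU A a X) (insert (DenseCU A True) (insert (DenseUcZ A True) ?U))"
    have fresh: "DenseVU A a X \<notin> insert (DenseCU A True) (insert (DenseUcZ A True) ?U)"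
      "DenseCU A True \<notin> insert (DenseUcZ A True) ?U" "DenseUcZ A True \<notin> ?U"
      by auto
    have deg: "gdegree c P x = (if x \<in> {Orig a, DenseU A X} then 1 else 0)
        + ((if x \<in> {Orig (c A), DenseC A} then 1 else 0)
        + ((if x \<in> {DenseC A, DenseZ A} then 1 else 0) + gdegree c ?U x))" for x
      unfolding P_def using fresh fin by (simp add: gdegree_insert)
    have "w {a, c A} = pot A a + pot A (c A)"
      using pot[OF dense] mixed E center_in[OF dense] by blast
    moreover have "sum ?w P = pot A a + pot A (c A)"
      unfolding P_def using fresh fin by (simp add: UZ_weight)
    ultimately have weight: "sum w {{a, c A}} = sum w {} + sum ?w P" by simp
    show ?thesis
    proof (rule solvedI[of "{{a, c A}}" "{}" P])
      show "P \<subseteq> dense_edges A" using X by (auto simp: P_def dense_edges_def)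
      show "finite P" using fin by (simp add: P_def)
      show "degree {{a, c A}} v = degree {} v + gdegree c P (Orig v)" for v
        using a by (simp add: deg degree_insert gdegree_DenseUZ)
      show "gdegree c P (DenseU A Z) = 1" if "Z \<in> ?C" for Z
        using that X by (auto simp: deg gdegree_DenseUZ)
      show "gdegree c P (DenseC A) = 2" "gdegree c P (DenseZ A) = card ?C"
        using card_X by (simp_all add: deg gdegree_DenseUZ)
    qed (use mixed weight center_in[OF dense] in auto)
  next
    case inner
    have neq: "c A \<noteq> x" "c A \<noteq> y" using inner E edge_neq by blast+
    have A: "x \<in> A" "y \<in> A" "c A \<in> A" using inner core_subset[OF dense] center_in[OF dense] by auto
    have xy: "{x, y} \<in> edges G"
      using core_adjacent[OF dense inner(1) A(2)] inner(3) by simp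
    let ?U = "DenseUZ A ` ?C"
    \<comment> \<open>The two parallel edges at the center saturate \<open>DenseC A\<close>, so
      every class vertex is joined to \<open>DenseZ A\<close>.\<close>
    define P where "P = insert (DenseCU A True) (insert (DenseCU A False) ?U)"
    have fresh: "DenseCU A True \<notin> insert (DenseCU A False) ?U" "DenseCU A False \<notin> ?U" by auto
    have deg: "gdegree c P z = (if z \<in> {Orig (c A), DenseC A} then 2 else 0) + gdegree c ?U z" for z
      unfolding P_def using fresh fin by (simp add: gdegree_insert)
    have ne: "{c A, x} \<noteq> {c A, y}" using inner(3) by (auto simp: doubleton_eq_iff)
    have "w {c A, x} = pot A (c A) + pot A x" "w {c A, y} = pot A (c A) + pot A y"
      using pot[OF dense] inner E A by blast+
    moreover have "w {x, y} = pot A x + pot A y"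
      using pot[OF dense] xy A by blast
    moreover have "sum ?w P = 2 * pot A (c A)"
      unfolding P_def using fresh fin by (simp add: UZ_weight)
    \<comment> \<open>Both sides equal \<open>2 * pot A (c A) + pot A x + pot A y\<close>.\<close>
    ultimately have weight: "sum w {{c A, x}, {c A, y}} = sum w {{x, y}} + sum ?w P"
      using ne by simp
    show ?thesis
    proof (rule solvedI[of "{{c A, x}, {c A, y}}" "{{x, y}}" P])
      show "P \<subseteq> dense_edges A" by (auto simp: P_def dense_edges_def)
      show "finite P" using fin by (simp add: P_def)
      show "degree {{c A, x}, {c A, y}} v = degree {{x, y}} v + gdegree c P (Orig v)" for v
        using neq inner(3) ne by (auto simp: deg degree_insert gdegree_DenseUZ)
      show "gdegree c P (DenseU A Z) = 1" if "Z \<in> ?C" for Z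
        using that by (auto simp: deg gdegree_DenseUZ)
      show "gdegree c P (DenseC A) = 2" "gdegree c P (DenseZ A) = card ?C"
        by (simp_all add: deg gdegree_DenseUZ)
    qed (use inner weight xy A in auto)
  qed
qed

section \<open>Assembling the matching\<close>

lemma finite_problematic: "finite (problematic_Kp2s p G w)"
proof (rule finite_imageD)
  show "inj_on (\<lambda>H. (verts H, edges H)) (problematic_Kp2s p G w)"
    by (auto simp: inj_on_def intro: graph.expand)
  show "finite ((\<lambda>H. (verts H, edges H)) ` problematic_Kp2s p G w)"
    by (rule finite_subset[of _ "Pow (verts G) \<times> Pow (edges G)"])
      (auto simp: problematic_Kp2s_def Kp2s_def subgraph_def finite_verts finite_edges)
qed

lemma finite_dense: "finite {A. dense p G A}"
  by (rule finite_subset[of _ "Pow (verts G)"]) (auto simp: dense_def finite_verts)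

text \<open>\<open>Mbar\<close> is first replaced by a minimum set \<open>N\<close> that is normal
  on every dense set carrying a gadget; both have the same weight by minimality. Then all gadget
  trades are combined.\<close>

theorem exists_lb_matching:
  assumes "minimal Mbar"
  shows "\<exists>M'. lb_matching (gadget_graph p t G w c) (gadget_lower p t G) (gadget_upper p t G) M'
    \<and> sum (gadget_weight G w c) M' = sum w Mbar"
proof -
  let ?D = "gadget_dense p G w c"
  have D: "dense p G A" if "A \<in> ?D" for A using that by (simp add: gadget_dense_def)
  have fin_D: "finite ?D" by (rule finite_subset[OF _ finite_dense]) (auto dest: D)
  obtain N where N: "minimal N" "\<And>A. A \<in> ?D \<Longrightarrow> normal A N"
    using normalize_all[OF fin_D D assms] by blast
  have weight: "sum w N = sum w Mbar"
    using N(1) assms by (auto simp: min_weight_Kp2_covering_co_t_matching_def intro: antisym)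
  have cov: "covering N" and NE: "N \<subseteq> edges G"
    using minimal_covering[OF N(1)] minimal_edges[OF N(1)] by auto
  \<comment> \<open>The sum type puts both kinds of gadgets into one index set.\<close>
  let ?I = "Inl ` problematic_Kp2s p G w \<union> Inr ` ?D"
  let ?A = "case_sum verts (\<lambda>A. A)"
  let ?L = "case_sum prob_edges dense_edges"
  let ?X = "case_sum prob_inner dense_inner"
  have "\<exists>M. M \<subseteq> OrigE ` edges G \<union> (\<Union>i\<in>?I. ?L i) \<and> finite M \<and>
      sum (gadget_weight G w c) M = sum w N \<and>
      (\<forall>v. gdegree c M (Orig v) = degree N v) \<and>
      (\<forall>i\<in>?I. \<forall>x\<in>?X i. gadget_lower p t G x \<le> gdegree c M x \<and> gdegree c M x \<le> gadget_upper p t G x) \<and>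
      (\<forall>e. (\<forall>i\<in>?I. \<not> e \<subseteq> ?A i) \<longrightarrow> (OrigE e \<in> M \<longleftrightarrow> e \<in> N))"
  proof (rule combine_gadgets[OF NE])
    show "finite ?I" using finite_problematic fin_D by simp
    show "gadget_solved N (?A i) (?L i) (?X i)" if "i \<in> ?I" for i
      using that problematic_solved[OF N(1)] dense_solved[OF N(1) D N(2)] by auto
    show "?A i \<inter> ?A j = {}" if "i \<in> ?I" "j \<in> ?I" "i \<noteq> j" for i j
      using that problematic_disjoint problematic_disjoint_dense[OF D] dense_disjoint_dense[OF D D]
      by (fastforce simp: Int_commute)
    show "?L i \<inter> ?L j = {}" if "i \<noteq> j" for i j
      using that by (cases i; cases j) (auto simp: prob_edges_def dense_edges_def)
    show "OrigE e \<notin> ?L i" for e i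
      by (cases i) (auto simp: prob_edges_def dense_edges_def)
    show "Orig v \<notin> ?X i" for v i
      by (cases i) (auto simp: prob_inner_def dense_inner_def)
    show "x \<notin> gends c e" if "i \<noteq> j" "e \<in> ?L i" "x \<in> ?X j" for i j e x
      using that
      by (cases i; cases j) (auto simp: prob_edges_def dense_edges_def prob_inner_def dense_inner_def)
  qed
  then obtain M where M: "M \<subseteq> OrigE ` edges G \<union> (\<Union>i\<in>?I. ?L i)"
    and M_weight: "sum (gadget_weight G w c) M = sum w N"
    and M_orig: "\<forall>v. gdegree c M (Orig v) = degree N v"
    and M_inner: "\<forall>i\<in>?I. \<forall>x\<in>?X i.
      gadget_lower p t G x \<le> gdegree c M x \<and> gdegree c M x \<le> gadget_upper p t G x"
    by (elim exE conjE) (rule that)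
  let ?G' = "gadget_graph p t G w c"
  have mdeg: "mdegree ?G' M x = gdegree c M x" for x
    by (simp add: mdegree_def gdegree_def gadget_graph_def)
  have "M \<subseteq> medges ?G'"
    using M by (auto simp: gadget_graph_def prob_edges_def dense_edges_def)
  moreover have "gadget_lower p t G x \<le> gdegree c M x \<and> gdegree c M x \<le> gadget_upper p t G x"
    if "x \<in> mverts ?G'" for x
  proof -
    from that consider (orig) v where "x = Orig v" "v \<in> verts G" |
      (prob) H where "H \<in> problematic_Kp2s p G w" "x \<in> prob_inner H" |
      (dense) A where "A \<in> ?D" "x \<in> dense_inner A"
      unfolding gadget_graph_def prob_inner_def dense_inner_def by auto
    then show ?thesis
    proof cases
      case orig
      \<comment> \<open>Trading preserved the degrees of \<open>N\<close>. The upper bound is the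
        degree in \<open>G\<close>, and the lower bound 1 at vertices of degree \<open>t + 1\<close>
        is the degree condition on a co-\<open>t\<close>-matching.\<close>
      have "degree N v \<le> degree (edges G) v"
        unfolding degree_def using NE finite_edges by (intro card_mono) auto
      moreover have "1 \<le> degree N v" if "degree (edges G) v = t + 1"
        using cov that orig(2) degree_pos_iff[OF NE] by (simp add: covering_iff)
      ultimately show ?thesis by (simp add: orig(1) M_orig)
    next
      case prob
      then show ?thesis using M_inner[rule_format, of "Inl H" x] by simp
    next
      case dense
      then show ?thesis using M_inner[rule_format, of "Inr A" x] by simp
    qed
  qed
  ultimately have "lb_matching ?G' (gadget_lower p t G) (gadget_upper p t G) M"
    by (simp add: lb_matching_def mdeg)
  then show ?thesis using M_weight weight by auto
qed

end

text \<open>The map \<open>c\<close> may be any choice of centers; ties between core vertices of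
  least potential are broken arbitrarily.\<close>

theorem theorem5:
  fixes p t :: nat
    and G :: "'a graph"
    and w :: "'a set \<Rightarrow> real"
    and c :: "'a set \<Rightarrow> 'a"
    and Mbar :: "'a set set"
  assumes "p \<ge> 3"
    and "t = 2 * p - 2"
    and "finite_simple_graph G"
    and "\<forall>v\<in>verts G. 1 \<le> degree (edges G) v \<and> degree (edges G) v \<le> t + 1"
    and "\<forall>e\<in>edges G. 0 \<le> w e"
    and "\<forall>H\<in>Kp2s p G. vertex_induced w H"
    and "\<forall>A. dense p G A \<longrightarrow> is_center t G w A (c A)"
    and "min_weight_Kp2_covering_co_t_matching p G t w Mbar"
  shows "\<exists>M'. lb_matching (gadget_graph p t G w c) (gadget_lower p t G) (gadget_upper p t G) M'
    \<and> sum (gadget_weight G w c) M' = sum w Mbar"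
proof -
  interpret kp2_instance p t G w c
    using assms by unfold_locales
  show ?thesis
    using assms(8) by (rule exists_lb_matching)
qed

end
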